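(* Let $(\eta,\overline{\boldsymbol u})$ be a sufficiently regular spatially periodic solution on the periodic cell $S_H$ of the location-uncertainty (LU) Serre-Green-Naghdi model defined in the context. Assume that the depth-averaged horizontal noise vanishes on $\partial S_H$ and that the depth-averaged horizontal noise and Itô-Stokes drift are divergence free: $$\nabla_H\cdot\overline{\boldsymbol\sigma\circ\mathrm d\boldsymbol B_t^H}=0,\qquad \nabla_H\cdot\overline{\boldsymbol u}_s=0 .$$ Then, pathwise, the energy $$E_{SGN}=\frac{\epsilon^2}{2}\int_{S_H}h\,\|\overline{\boldsymbol u}\|^2\,\mathrm dS_H+\frac12\int_{S_H}h^2\,\mathrm dS_H+\frac{\epsilon^3\beta^2}{6}\int_{S_H}h^3\,(\nabla_H\cdot\overline{\boldsymbol u})^2\,\mathrm dS_H,\qquad h=1+\epsilon\eta,$$ is conserved: $\mathrm d_tE_{SGN}=0$.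
   Context: Let $d\in\{1,2\}$ and let $S_H\subset\mathbb R^d$ be a bounded interval ($d=1$) or rectangle ($d=2$), regarded as a periodic cell: all fields below and their spatial derivatives satisfy periodic boundary conditions on $\partial S_H$. $\nabla_H$ and $\nabla_H\cdot$ are the gradient and divergence in the horizontal variables. The parameters $\epsilon,\beta,\Upsilon>0$ are constants. All quantities are nondimensional. Work on a filtered probability space carrying independent standard one-dimensional Brownian motions $(\beta^n)_n$. The unknowns are the surface elevation $\eta(\boldsymbol x,t)\in\mathbb R$ and the depth-averaged horizontal velocity $\overline{\boldsymbol u}(\boldsymbol x,t)\in\mathbb R^d$; the water depth is $h=1+\epsilon\eta$, assumed positive. The depth-averaged Itô-Stokes drift $\overline{\boldsymbol u}_s(\boldsymbol x,t)\in\mathbb R^d$ is a periodic field. The depth-averaged horizontal noise is $\overline{\boldsymbol\sigma\circ\mathrm d\boldsymbol B_t^H}=\sum_n\boldsymbol\varphi_n(\boldsymbol x,t)\circ\mathrm d\beta^n_t$ with $\mathbb R^d$-valued spatially periodic fields $\boldsymbol\varphi_n$ (Stratonovich sense). "The noise vanishes on $\partial S_H$" means that every $\boldsymbol\varphi_n$ vanishes there, and "the noise is divergence free" means $\nabla_H\cdot\boldsymbol\varphi_n=0$ for every $n$. Set $\overline{\boldsymbol u}^*=\overline{\boldsymbol u}-\tfrac12\Upsilon\epsilon\,\overline{\boldsymbol u}_s$. All stochastic differentials and products of processes with stochastic differentials are in the Stratonovich sense, $\mathrm d_t$ denotes the time differential at fixed $\boldsymbol x$ (or of a space-independent process), and for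 a scalar or vector field $f$ $$\overline D^H_t f=\mathrm d_t f+\epsilon(\overline{\boldsymbol u}^*\cdot\nabla_H)f\,\mathrm dt+\Upsilon^{1/2}\epsilon\,(\overline{\boldsymbol\sigma\circ\mathrm d\boldsymbol B_t^H}\cdot\nabla_H)f .$$ The LU Serre-Green-Naghdi model is the system $$\overline D^H_t\eta=-h\big(\nabla_H\cdot\overline{\boldsymbol u}^*\,\mathrm dt+\Upsilon^{1/2}\nabla_H\cdot\overline{\boldsymbol\sigma\circ\mathrm d\boldsymbol B_t^H}\big),$$ $$\overline D^H_t\overline{\boldsymbol u}+\nabla_H\eta\,\mathrm dt-\frac1h\,\epsilon\beta^2\,\nabla_H\Big(\frac{h^3}{3}\,\mathrm d\overline G\Big)=0,$$ $$\mathrm d\overline G=\overline D^H_t(\nabla_H\cdot\overline{\boldsymbol u})-\epsilon\,\nabla_H\cdot\big(\overline{\boldsymbol u}^*\,\mathrm dt+\Upsilon^{1/2}\overline{\boldsymbol\sigma\circ\mathrm d\boldsymbol B_t^H}\big)\,\nabla_H\cdot\overline{\boldsymbol u} .$$ "Sufficiently regular" means: $\eta,\overline{\boldsymbol u}$ are continuous semimartingales in time with values in spatially smooth periodic fields, the coefficients $\overline{\boldsymbol u}_s,\boldsymbol\varphi_n$ are smooth in space and are such that all sums and Stratonovich integrals converge, and the Stratonovich product rule, spatial differentiation and integration over $S_H$ may be applied to and interchanged with the stochastic differentials. *)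

theory Defs
  imports "HOL-Probability.Probability"
begin

section \<open>Filtered probability spaces, semimartingales and Brownian motions on [0,T]\<close>

type_synonym 'w process = "real \<Rightarrow> 'w \<Rightarrow> real"

definition filtered_prob_space :: "'w measure \<Rightarrow> (real \<Rightarrow> 'w measure) \<Rightarrow> bool" where
  "filtered_prob_space M F \<longleftrightarrow>
     prob_space M \<and> filtration (space M) F \<and> (\<forall>t. sets (F t) \<subseteq> sets M)"

definition adapted :: "(real \<Rightarrow> 'w measure) \<Rightarrow> real \<Rightarrow> 'w process \<Rightarrow> bool" where
  "adapted F T X \<longleftrightarrow> (\<forall>t\<in>{0..T}. X t \<in> borel_measurable (F t))"

definition continuous_paths :: "'w measure \<Rightarrow> real \<Rightarrow> 'w process \<Rightarrow> bool" where
  "continuous_paths M T X \<longleftrightarrow> (\<forall>\<omega>\<in>space M. continuous_on {0..T} (\<lambda>t. X t \<omega>))"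

definition is_martingale :: "'w measure \<Rightarrow> (real \<Rightarrow> 'w measure) \<Rightarrow> real \<Rightarrow> 'w process \<Rightarrow> bool" where
  "is_martingale M F T X \<longleftrightarrow>
     adapted F T X \<and> (\<forall>t\<in>{0..T}. integrable M (X t)) \<and>
     (\<forall>s\<in>{0..T}. \<forall>t\<in>{s..T}. AE \<omega> in M. real_cond_exp M (F s) (X t) \<omega> = X s \<omega>)"

definition cont_local_martingale ::
    "'w measure \<Rightarrow> (real \<Rightarrow> 'w measure) \<Rightarrow> real \<Rightarrow> 'w process \<Rightarrow> bool" where
  "cont_local_martingale M F T X \<longleftrightarrow>
     adapted F T X \<and> continuous_paths M T X \<and>
     (\<exists>\<tau> :: nat \<Rightarrow> 'w \<Rightarrow> real.
        (\<forall>n. stopping_time F (\<tau> n)) \<and>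
        (\<forall>n. \<forall>\<omega>\<in>space M. 0 \<le> \<tau> n \<omega> \<and> \<tau> n \<omega> \<le> \<tau> (Suc n) \<omega>) \<and>
        (AE \<omega> in M. \<exists>n. T \<le> \<tau> n \<omega>) \<and>
        (\<forall>n. is_martingale M F T (\<lambda>t \<omega>. X (min t (\<tau> n \<omega>)) \<omega> - X 0 \<omega>)))"

text \<open>The partition \<open>0 = p 0 \<le> \<dots> \<le> p n = t\<close> of \<open>[0,t]\<close>.\<close>

definition is_partition :: "(nat \<Rightarrow> real) \<Rightarrow> nat \<Rightarrow> real \<Rightarrow> bool" where
  "is_partition p n t \<longleftrightarrow> p 0 = 0 \<and> p n = t \<and> (\<forall>k<n. p k \<le> p (Suc k))"

definition bounded_variation_path :: "real \<Rightarrow> (real \<Rightarrow> real) \<Rightarrow> bool" where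
  "bounded_variation_path T v \<longleftrightarrow>
     (\<exists>B. \<forall>p n. is_partition p n T \<longrightarrow> (\<Sum>k<n. \<bar>v (p (Suc k)) - v (p k)\<bar>) \<le> B)"

definition cont_semimartingale ::
    "'w measure \<Rightarrow> (real \<Rightarrow> 'w measure) \<Rightarrow> real \<Rightarrow> 'w process \<Rightarrow> bool" where
  "cont_semimartingale M F T X \<longleftrightarrow>
     adapted F T X \<and> continuous_paths M T X \<and>
     (\<exists>L V. cont_local_martingale M F T L \<and>
        adapted F T V \<and> continuous_paths M T V \<and>
        (\<forall>\<omega>\<in>space M. bounded_variation_path T (\<lambda>t. V t \<omega>)) \<and>
        (\<forall>t\<in>{0..T}. \<forall>\<omega>\<in>space M. X t \<omega> = L t \<omega> + V t \<omega>))"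

definition brownian_motion ::
    "'w measure \<Rightarrow> (real \<Rightarrow> 'w measure) \<Rightarrow> real \<Rightarrow> 'w process \<Rightarrow> bool" where
  "brownian_motion M F T B \<longleftrightarrow>
     adapted F T B \<and> continuous_paths M T B \<and> (\<forall>\<omega>\<in>space M. B 0 \<omega> = 0) \<and>
     (\<forall>s t. 0 \<le> s \<and> s < t \<and> t \<le> T \<longrightarrow>
        distributed M lborel (\<lambda>\<omega>. B t \<omega> - B s \<omega>) (normal_density 0 (sqrt (t - s))) \<and>
        prob_space.indep_set M (sets (F s))
          (sets (vimage_algebra (space M) (\<lambda>\<omega>. B t \<omega> - B s \<omega>) borel)))"

definition independent_brownian_motions ::
    "'w measure \<Rightarrow> (real \<Rightarrow> 'w measure) \<Rightarrow> real \<Rightarrow> nat set \<Rightarrow> (nat \<Rightarrow> 'w process) \<Rightarrow> bool" where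
  "independent_brownian_motions M F T N B \<longleftrightarrow>
     (\<forall>n\<in>N. brownian_motion M F T (B n)) \<and>
     prob_space.indep_vars M (\<lambda>_. Pi\<^sub>M {0..T} (\<lambda>_. borel)) (\<lambda>n \<omega>. \<lambda>t\<in>{0..T}. B n t \<omega>) N"

section \<open>Stratonovich integrals\<close>

text \<open>
  The Stratonovich integral is the limit in probability, as the mesh of the partition tends to 0,
  of the sums with averaged integrand. Measurability is demanded explicitly because
  \<open>measure M\<close> is 0 on non-measurable sets. For these sums the two-factor Stratonovich
  product rule is exact (summation by parts).
\<close>

definition strat_sum :: "'w process \<Rightarrow> 'w process \<Rightarrow> (nat \<Rightarrow> real) \<Rightarrow> nat \<Rightarrow> 'w \<Rightarrow> real" where
  "strat_sum X Y p n \<omega> =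
     (\<Sum>k<n. (X (p k) \<omega> + X (p (Suc k)) \<omega>) / 2 * (Y (p (Suc k)) \<omega> - Y (p k) \<omega>))"

definition has_strat_integral ::
    "'w measure \<Rightarrow> real \<Rightarrow> 'w process \<Rightarrow> 'w process \<Rightarrow> 'w process \<Rightarrow> bool" where
  "has_strat_integral M T X Y J \<longleftrightarrow>
     (\<forall>t\<in>{0..T}. X t \<in> borel_measurable M \<and> Y t \<in> borel_measurable M \<and> J t \<in> borel_measurable M) \<and>
     (\<forall>t\<in>{0..T}. \<forall>e>0. \<forall>q>0. \<exists>r>0. \<forall>p n.
        is_partition p n t \<and> (\<forall>k<n. p (Suc k) - p k < r) \<longrightarrow>
        measure M {\<omega>\<in>space M. e \<le> \<bar>strat_sum X Y p n \<omega> - J t \<omega>\<bar>} < q)"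

definition tendsto_in_prob :: "'w measure \<Rightarrow> (nat \<Rightarrow> 'w \<Rightarrow> real) \<Rightarrow> ('w \<Rightarrow> real) \<Rightarrow> bool" where
  "tendsto_in_prob M X L \<longleftrightarrow>
     (\<forall>m. X m \<in> borel_measurable M) \<and> L \<in> borel_measurable M \<and>
     (\<forall>e>0. (\<lambda>m. measure M {\<omega>\<in>space M. e \<le> \<bar>X m \<omega> - L \<omega>\<bar>}) \<longlonglongrightarrow> 0)"

text \<open>\<open>W t = \<Sum>n\<in>N. \<integral>\<^sub>0\<^sup>t \<phi> n \<circ> dB n\<close>, with \<open>N\<close> finite or infinite.\<close>

definition has_noise_integral ::
    "'w measure \<Rightarrow> real \<Rightarrow> nat set \<Rightarrow> (nat \<Rightarrow> 'w process) \<Rightarrow> (nat \<Rightarrow> 'w process) \<Rightarrow> 'w process \<Rightarrow> bool" where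
  "has_noise_integral M T N B \<phi> W \<longleftrightarrow>
     (\<exists>J. (\<forall>n\<in>N. has_strat_integral M T (\<phi> n) (B n) (J n)) \<and>
        (\<forall>t\<in>{0..T}. tendsto_in_prob M (\<lambda>m \<omega>. \<Sum>n | n \<in> N \<and> n < m. J n t \<omega>) (W t)))"

section \<open>Random fields on the periodic cell\<close>

text \<open>
  Fields on the periodic cell \<open>cbox a b\<close> are represented by their periodic extensions to
  \<open>real^'d\<close>; the arguments are position, time and sample point.
\<close>

type_synonym ('d, 'w) field = "real^'d \<Rightarrow> real \<Rightarrow> 'w \<Rightarrow> real"
type_synonym ('d, 'w) vfield = "real^'d \<Rightarrow> real \<Rightarrow> 'w \<Rightarrow> real^'d"

definition pd :: "'d::finite \<Rightarrow> (real^'d \<Rightarrow> real) \<Rightarrow> real^'d \<Rightarrow> real" where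
  "pd i f x = frechet_derivative f (at x) (axis i 1)"

definition smooth_periodic :: "real^'d::finite \<Rightarrow> real^'d \<Rightarrow> (real^'d \<Rightarrow> real) \<Rightarrow> bool" where
  "smooth_periodic a b f \<longleftrightarrow>
     (\<forall>is. foldr pd is f differentiable_on UNIV) \<and>
     (\<forall>x i. f (x + (b $ i - a $ i) *\<^sub>R axis i 1) = f x)"

definition dx :: "'d::finite \<Rightarrow> ('d, 'w) field \<Rightarrow> ('d, 'w) field" where
  "dx i f = (\<lambda>x t \<omega>. pd i (\<lambda>y. f y t \<omega>) x)"

definition cmp :: "('d::finite, 'w) vfield \<Rightarrow> 'd \<Rightarrow> ('d, 'w) field" where
  "cmp v i = (\<lambda>x t \<omega>. v x t \<omega> $ i)"

definition dv :: "('d::finite, 'w) vfield \<Rightarrow> ('d, 'w) field" where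
  "dv v = (\<lambda>x t \<omega>. \<Sum>i\<in>UNIV. dx i (cmp v i) x t \<omega>)"

text \<open>
  Continuous semimartingales in time with values in the space of smooth periodic fields
  (with its \<open>C\<^sup>\<infinity>\<close> topology: all spatial derivatives are jointly continuous).
\<close>

definition semimartingale_field ::
    "'w measure \<Rightarrow> (real \<Rightarrow> 'w measure) \<Rightarrow> real \<Rightarrow> real^'d \<Rightarrow> real^'d \<Rightarrow> ('d::finite, 'w) field \<Rightarrow> bool" where
  "semimartingale_field M F T a b f \<longleftrightarrow>
     (\<forall>x. cont_semimartingale M F T (f x)) \<and>
     (\<forall>\<omega>\<in>space M.
        (\<forall>t\<in>{0..T}. smooth_periodic a b (\<lambda>x. f x t \<omega>)) \<and>
        (\<forall>is. continuous_on (UNIV \<times> {0..T}) (\<lambda>(x, t). foldr pd is (\<lambda>y. f y t \<omega>) x)))"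

definition drift_field ::
    "'w measure \<Rightarrow> real \<Rightarrow> real^'d \<Rightarrow> real^'d \<Rightarrow> ('d::finite, 'w) field \<Rightarrow> bool" where
  "drift_field M T a b f \<longleftrightarrow>
     (\<forall>\<omega>\<in>space M.
        (\<forall>t\<in>{0..T}. smooth_periodic a b (\<lambda>x. f x t \<omega>)) \<and>
        (\<forall>x. (\<lambda>t. f x t \<omega>) absolutely_integrable_on {0..T}))"

section \<open>Stochastic differentials of fields\<close>

text \<open>
  A stochastic differential is represented by a process having that differential, so equality of
  differentials is equality of the increments from time 0, at each point, up to a null set.
\<close>

definition deq :: "'w measure \<Rightarrow> real \<Rightarrow> ('d, 'w) field \<Rightarrow> ('d, 'w) field \<Rightarrow> bool" where
  "deq M T f g \<longleftrightarrow>
     (\<forall>x. AE \<omega> in M. \<forall>t\<in>{0..T}. f x t \<omega> - f x 0 \<omega> = g x t \<omega> - g x 0 \<omega>)"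

definition tint :: "('d, 'w) field \<Rightarrow> ('d, 'w) field" where
  "tint f = (\<lambda>x t \<omega>. integral {0..t} (\<lambda>s. f x s \<omega>))"

text \<open>
  \<open>sint M T A f g\<close> is a field in \<open>A\<close> with differential \<open>f \<circ> dg\<close>. All choices in a set \<open>A\<close> of
  semimartingale fields are indistinguishable.
\<close>

definition sint ::
    "'w measure \<Rightarrow> real \<Rightarrow> ('d, 'w) field set \<Rightarrow> ('d, 'w) field \<Rightarrow> ('d, 'w) field \<Rightarrow> ('d, 'w) field" where
  "sint M T A f g = (SOME J. J \<in> A \<and> (\<forall>x. has_strat_integral M T (f x) (g x) (J x)))"

text \<open>
  The rules of Stratonovich calculus hold for the class \<open>A\<close> of semimartingale fields and the
  class \<open>D\<close> of integrands of \<open>dt\<close>: the integrals exist in \<open>A\<close>, products of processes with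
  differentials satisfy \<open>f \<circ> (g \<circ> dk) = (f g) \<circ> dk\<close> (which, with the product rule for two
  factors, gives it for any number of factors), and spatial derivatives
  obey the Leibniz rule \<open>\<partial>(f \<circ> dg) = \<partial>f \<circ> dg + f \<circ> d\<partial>g\<close> and \<open>\<partial>(f dt) = \<partial>f dt\<close>.
\<close>

definition strat_calculus ::
    "'w measure \<Rightarrow> (real \<Rightarrow> 'w measure) \<Rightarrow> real \<Rightarrow> real^'d \<Rightarrow> real^'d \<Rightarrow>
     ('d::finite, 'w) field set \<Rightarrow> ('d, 'w) field set \<Rightarrow> bool" where
  "strat_calculus M F T a b A D \<longleftrightarrow>
     (\<forall>f\<in>A. semimartingale_field M F T a b f) \<and>
     (\<forall>c. (\<lambda>x t \<omega>. c) \<in> A) \<and>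
     (\<forall>f\<in>A. \<forall>g\<in>A. (\<lambda>x t \<omega>. f x t \<omega> + g x t \<omega>) \<in> A) \<and>
     (\<forall>f\<in>A. \<forall>g\<in>A. (\<lambda>x t \<omega>. f x t \<omega> * g x t \<omega>) \<in> A) \<and>
     (\<forall>f\<in>A. \<forall>i. dx i f \<in> A) \<and>
     (\<forall>f\<in>A. \<forall>g\<in>A. \<exists>J\<in>A. \<forall>x. has_strat_integral M T (f x) (g x) (J x)) \<and>
     (\<forall>f\<in>A. \<forall>g\<in>A. \<forall>k\<in>A.
        deq M T (sint M T A f (sint M T A g k)) (sint M T A (\<lambda>x t \<omega>. f x t \<omega> * g x t \<omega>) k)) \<and>
     (\<forall>f\<in>A. \<forall>g\<in>A. \<forall>i.
        deq M T (dx i (sint M T A f g))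
          (\<lambda>x t \<omega>. sint M T A (dx i f) g x t \<omega> + sint M T A f (dx i g) x t \<omega>)) \<and>
     A \<subseteq> D \<and>
     (\<forall>f\<in>D. drift_field M T a b f) \<and>
     (\<forall>f\<in>D. \<forall>g\<in>D. (\<lambda>x t \<omega>. f x t \<omega> + g x t \<omega>) \<in> D) \<and>
     (\<forall>f\<in>A. \<forall>g\<in>D. (\<lambda>x t \<omega>. f x t \<omega> * g x t \<omega>) \<in> D) \<and>
     (\<forall>f\<in>D. \<forall>i. dx i f \<in> D) \<and>
     (\<forall>f\<in>D. tint f \<in> A) \<and>
     (\<forall>f\<in>D. \<forall>i. deq M T (dx i (tint f)) (tint (dx i f)))"

section \<open>The LU Serre-Green-Naghdi model\<close>

text \<open>
  \<open>W\<close> is the vector field whose differential is the noise \<open>\<Sum>n\<in>N. \<phi> n \<circ> dB n\<close>; spatial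
  differentiation is interchanged with the sum and the integrals.
\<close>

definition noise_field ::
    "'w measure \<Rightarrow> real \<Rightarrow> real^'d \<Rightarrow> real^'d \<Rightarrow> ('d::finite, 'w) field set \<Rightarrow>
     nat set \<Rightarrow> (nat \<Rightarrow> 'w process) \<Rightarrow> (nat \<Rightarrow> ('d, 'w) vfield) \<Rightarrow> ('d, 'w) vfield \<Rightarrow> bool" where
  "noise_field M T a b A N B \<phi> W \<longleftrightarrow>
     (\<forall>n\<in>N. \<forall>i. \<forall>\<omega>\<in>space M. \<forall>t\<in>{0..T}. smooth_periodic a b (\<lambda>x. cmp (\<phi> n) i x t \<omega>)) \<and>
     (\<forall>i. cmp W i \<in> A) \<and>
     (\<forall>i x. has_noise_integral M T N B (\<lambda>n. cmp (\<phi> n) i x) (cmp W i x)) \<and>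
     (\<forall>i j x. has_noise_integral M T N B (\<lambda>n. dx j (cmp (\<phi> n) i) x) (dx j (cmp W i) x))"

definition ustar :: "real \<Rightarrow> real \<Rightarrow> ('d::finite, 'w) vfield \<Rightarrow> ('d, 'w) vfield \<Rightarrow> ('d, 'w) vfield" where
  "ustar \<epsilon> \<Upsilon> u us = (\<lambda>x t \<omega>. u x t \<omega> - (1/2 * \<Upsilon> * \<epsilon>) *\<^sub>R us x t \<omega>)"

definition depth :: "real \<Rightarrow> ('d, 'w) field \<Rightarrow> ('d, 'w) field" where
  "depth \<epsilon> \<eta> = (\<lambda>x t \<omega>. 1 + \<epsilon> * \<eta> x t \<omega>)"

text \<open>A field with differential \<open>D\<^sub>t f\<close>.\<close>

definition transport ::
    "'w measure \<Rightarrow> real \<Rightarrow> ('d::finite, 'w) field set \<Rightarrow> real \<Rightarrow> real \<Rightarrow>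
     ('d, 'w) vfield \<Rightarrow> ('d, 'w) vfield \<Rightarrow> ('d, 'w) vfield \<Rightarrow> ('d, 'w) field \<Rightarrow> ('d, 'w) field" where
  "transport M T A \<epsilon> \<Upsilon> u us W f = (\<lambda>x t \<omega>.
     f x t \<omega>
     + \<epsilon> * tint (\<lambda>x t \<omega>. \<Sum>i\<in>UNIV. ustar \<epsilon> \<Upsilon> u us x t \<omega> $ i * dx i f x t \<omega>) x t \<omega>
     + sqrt \<Upsilon> * \<epsilon> * (\<Sum>i\<in>UNIV. sint M T A (dx i f) (cmp W i) x t \<omega>))"

definition LU_G ::
    "'w measure \<Rightarrow> real \<Rightarrow> ('d::finite, 'w) field set \<Rightarrow> real \<Rightarrow> real \<Rightarrow>
     ('d, 'w) vfield \<Rightarrow> ('d, 'w) vfield \<Rightarrow> ('d, 'w) vfield \<Rightarrow> ('d, 'w) field" where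
  "LU_G M T A \<epsilon> \<Upsilon> u us W = (\<lambda>x t \<omega>.
     transport M T A \<epsilon> \<Upsilon> u us W (dv u) x t \<omega>
     - \<epsilon> * (tint (\<lambda>x t \<omega>. dv (ustar \<epsilon> \<Upsilon> u us) x t \<omega> * dv u x t \<omega>) x t \<omega>
          + sqrt \<Upsilon> * sint M T A (dv u) (dv W) x t \<omega>))"

definition LU_SGN ::
    "'w measure \<Rightarrow> real \<Rightarrow> ('d::finite, 'w) field set \<Rightarrow> real \<Rightarrow> real \<Rightarrow> real \<Rightarrow>
     ('d, 'w) field \<Rightarrow> ('d, 'w) vfield \<Rightarrow> ('d, 'w) vfield \<Rightarrow> ('d, 'w) vfield \<Rightarrow> bool" where
  "LU_SGN M T A \<epsilon> \<beta> \<Upsilon> \<eta> u us W \<longleftrightarrow>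
     (let h = depth \<epsilon> \<eta>;
          K = sint M T A (\<lambda>x t \<omega>. h x t \<omega> ^ 3 / 3) (LU_G M T A \<epsilon> \<Upsilon> u us W)
      in deq M T (transport M T A \<epsilon> \<Upsilon> u us W \<eta>)
           (\<lambda>x t \<omega>. - (tint (\<lambda>x t \<omega>. h x t \<omega> * dv (ustar \<epsilon> \<Upsilon> u us) x t \<omega>) x t \<omega>
                       + sqrt \<Upsilon> * sint M T A h (dv W) x t \<omega>)) \<and>
         (\<forall>j. deq M T
           (\<lambda>x t \<omega>. transport M T A \<epsilon> \<Upsilon> u us W (cmp u j) x t \<omega>
                    + tint (dx j \<eta>) x t \<omega>
                    - \<epsilon> * \<beta>\<^sup>2 * sint M T A (\<lambda>x t \<omega>. 1 / h x t \<omega>) (dx j K) x t \<omega>)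
           (\<lambda>x t \<omega>. 0)))"

definition SGN_energy ::
    "real^'d \<Rightarrow> real^'d \<Rightarrow> real \<Rightarrow> real \<Rightarrow> ('d::finite, 'w) field \<Rightarrow> ('d, 'w) vfield \<Rightarrow> 'w process" where
  "SGN_energy a b \<epsilon> \<beta> \<eta> u = (\<lambda>t \<omega>.
     \<epsilon>\<^sup>2 / 2 * integral (cbox a b) (\<lambda>x. depth \<epsilon> \<eta> x t \<omega> * (norm (u x t \<omega>))\<^sup>2)
     + 1 / 2 * integral (cbox a b) (\<lambda>x. (depth \<epsilon> \<eta> x t \<omega>)\<^sup>2)
     + \<epsilon> ^ 3 * \<beta>\<^sup>2 / 6 * integral (cbox a b) (\<lambda>x. depth \<epsilon> \<eta> x t \<omega> ^ 3 * (dv u x t \<omega>)\<^sup>2))"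

end

theory Submission
  imports Defs
begin

text \<open>
  The idea is to prove a local conservation law first and to integrate over the cell last, so that
  no stochastic Fubini theorem is needed. Stochastic differentials are handled through the
  relation \<open>f \<doteq> g\<close> (equality of the differentials of \<open>f\<close> and \<open>g\<close>): the Stratonovich
  integral is bilinear, satisfies the product rule, and reduces to a time integral against
  \<open>g dt\<close>, because all of this holds for the approximating sums along uniform partitions
  and limits in probability are unique.

  Let \<open>dV = \<epsilon> (u\<^sup>* dt + \<Upsilon>\<^bsup>1/2\<^esup> dW)\<close> be the stochastic displacement
  (\<open>displacement\<close>), \<open>D f = df + dV \<cdot> \<nabla>f\<close> the material derivative (\<open>adv\<close>), which is
  a derivation (\<open>adv_mult\<close>), and \<open>w = div u\<close>. As noise and drift are divergence free,
  \<open>div dV = \<epsilon> w dt\<close> (\<open>div_displacement\<close>), and the model reads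
  \<open>D h = - \<epsilon> h w dt\<close>, \<open>D u\<^sub>j = - \<partial>\<^sub>j \<eta> dt + c h\<^sup>-\<^sup>1 \<partial>\<^sub>j dK\<close>,
  \<open>dG = D w - \<epsilon> w\<^sup>2 dt\<close>, with \<open>c = \<epsilon> \<beta>\<^sup>2\<close> and \<open>dK = h\<^sup>3/3 dG\<close>. The
  first equation is a continuity equation, so \<open>d(h f) + div (h f dV) = h D f\<close> for every
  \<open>f\<close> (\<open>adv_conservative\<close>). The energy density is \<open>e = h f\<close> with
  \<open>f = \<epsilon>\<^sup>2/2 |u|\<^sup>2 + h/2 + \<epsilon>\<^sup>2 c/6 (h w)\<^sup>2\<close>. Since \<open>D (h w) = h dG\<close>,
  \<open>h D f = \<epsilon>\<^sup>2 \<Sum>\<^sub>j (- h u\<^sub>j \<partial>\<^sub>j \<eta> dt + c u\<^sub>j \<partial>\<^sub>j dK) - (\<epsilon>/2) h\<^sup>2 w dt + \<epsilon>\<^sup>2 c w dK\<close>,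
  which equals \<open>\<Sum>\<^sub>j \<partial>\<^sub>j (\<epsilon>\<^sup>2 c u\<^sub>j dK - (\<epsilon>/2) h\<^sup>2 u\<^sub>j dt)\<close>,
  using \<open>\<nabla>h = \<epsilon> \<nabla>\<eta>\<close>. Hence \<open>de\<close> is a divergence of periodic fields
  (\<open>local_energy_law\<close>). It holds almost surely at all points simultaneously by continuity
  (\<open>deq_all_points\<close>), and its integral over the cell vanishes by periodicity
  (\<open>integral_conserved\<close>).
\<close>

section \<open>Limits in probability\<close>

lemma tendsto_in_prob_measurable:
  assumes "tendsto_in_prob M X L"
  shows "X m \<in> borel_measurable M" "L \<in> borel_measurable M"
  using assms unfolding tendsto_in_prob_def by auto

lemma tendsto_in_probD:
  assumes "tendsto_in_prob M X L" "0 < e"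
  shows "(\<lambda>m. measure M {\<omega>\<in>space M. e \<le> \<bar>X m \<omega> - L \<omega>\<bar>}) \<longlonglongrightarrow> 0"
  using assms unfolding tendsto_in_prob_def by auto

lemma tendsto_in_prob_unique:
  assumes M: "prob_space M" and X: "tendsto_in_prob M X L" and Y: "tendsto_in_prob M X K"
  shows "AE \<omega> in M. L \<omega> = K \<omega>"
proof -
  interpret prob_space M by fact
  have [measurable]: "X m \<in> borel_measurable M" "L \<in> borel_measurable M" "K \<in> borel_measurable M" for m
    using X Y unfolding tendsto_in_prob_def by auto
  have "AE \<omega> in M. \<bar>L \<omega> - K \<omega>\<bar> < 1 / real (Suc n)" for n
  proof -
    define e where "e = 1 / real (Suc n)"
    have e: "0 < e / 2" by (simp add: e_def)
    let ?P = "\<lambda>m. measure M {\<omega>\<in>space M. e / 2 \<le> \<bar>X m \<omega> - L \<omega>\<bar>}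
        + measure M {\<omega>\<in>space M. e / 2 \<le> \<bar>X m \<omega> - K \<omega>\<bar>}"
    have lim: "?P \<longlonglongrightarrow> 0 + 0"
      using e by (intro tendsto_add tendsto_in_probD[OF X] tendsto_in_probD[OF Y]) simp_all
    have "measure M {\<omega>\<in>space M. e \<le> \<bar>L \<omega> - K \<omega>\<bar>} \<le> ?P m" for m
    proof -
      have "measure M {\<omega>\<in>space M. e \<le> \<bar>L \<omega> - K \<omega>\<bar>}
          \<le> measure M ({\<omega>\<in>space M. e / 2 \<le> \<bar>X m \<omega> - L \<omega>\<bar>} \<union> {\<omega>\<in>space M. e / 2 \<le> \<bar>X m \<omega> - K \<omega>\<bar>})" (is "measure M ?A \<le> measure M ?B")
      proof (rule finite_measure_mono)
        have "e / 2 \<le> \<bar>X m \<omega> - L \<omega>\<bar> \<or> e / 2 \<le> \<bar>X m \<omega> - K \<omega>\<bar>" if "e \<le> \<bar>L \<omega> - K \<omega>\<bar>" for \<omega>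
          using that by linarith
        then show "?A \<subseteq> ?B" by blast
      qed measurable
      also have "\<dots> \<le> ?P m" by (rule measure_Un_le; measurable)
      finally show ?thesis .
    qed
    then have "measure M {\<omega>\<in>space M. e \<le> \<bar>L \<omega> - K \<omega>\<bar>} \<le> 0"
      using LIMSEQ_le_const[OF lim] by auto
    then have "prob {\<omega>\<in>space M. e \<le> \<bar>L \<omega> - K \<omega>\<bar>} = 0"
      using measure_nonneg[of M] by (simp add: order.antisym)
    then have "AE \<omega> in M. \<not> (e \<le> \<bar>L \<omega> - K \<omega>\<bar>)"
      by (subst (asm) prob_Collect_eq_0) auto
    then show ?thesis by (simp add: e_def not_le)
  qed
  then have "AE \<omega> in M. \<forall>n. \<bar>L \<omega> - K \<omega>\<bar> < 1 / real (Suc n)"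
    by (simp add: AE_all_countable)
  then show ?thesis
  proof eventually_elim
    case (elim \<omega>)
    show ?case
    proof (rule ccontr)
      assume "L \<omega> \<noteq> K \<omega>"
      then have "0 < \<bar>L \<omega> - K \<omega>\<bar>" by simp
      from nat_approx_posE[OF this] obtain n where "1 / real (Suc n) < \<bar>L \<omega> - K \<omega>\<bar>" by auto
      with elim show False by (meson less_asym)
    qed
  qed
qed

lemma tendsto_in_prob_add:
  assumes M: "prob_space M" and X: "tendsto_in_prob M X L" and Y: "tendsto_in_prob M Y K"
  shows "tendsto_in_prob M (\<lambda>m \<omega>. X m \<omega> + Y m \<omega>) (\<lambda>\<omega>. L \<omega> + K \<omega>)"
proof -
  interpret prob_space M by fact
  have [measurable]: "X m \<in> borel_measurable M" "L \<in> borel_measurable M"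
    "Y m \<in> borel_measurable M" "K \<in> borel_measurable M" for m
    using X Y unfolding tendsto_in_prob_def by auto
  have "(\<lambda>m. measure M {\<omega>\<in>space M. e \<le> \<bar>X m \<omega> + Y m \<omega> - (L \<omega> + K \<omega>)\<bar>}) \<longlonglongrightarrow> 0"
    if e: "0 < e" for e
  proof -
    let ?P = "\<lambda>m. measure M {\<omega>\<in>space M. e / 2 \<le> \<bar>X m \<omega> - L \<omega>\<bar>}
        + measure M {\<omega>\<in>space M. e / 2 \<le> \<bar>Y m \<omega> - K \<omega>\<bar>}"
    have lim: "?P \<longlonglongrightarrow> 0 + 0"
      using e by (intro tendsto_add tendsto_in_probD[OF X] tendsto_in_probD[OF Y]) simp_all
    have "measure M {\<omega>\<in>space M. e \<le> \<bar>X m \<omega> + Y m \<omega> - (L \<omega> + K \<omega>)\<bar>} \<le> ?P m" for m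
    proof -
      have "measure M {\<omega>\<in>space M. e \<le> \<bar>X m \<omega> + Y m \<omega> - (L \<omega> + K \<omega>)\<bar>}
          \<le> measure M ({\<omega>\<in>space M. e / 2 \<le> \<bar>X m \<omega> - L \<omega>\<bar>} \<union> {\<omega>\<in>space M. e / 2 \<le> \<bar>Y m \<omega> - K \<omega>\<bar>})" (is "measure M ?A \<le> measure M ?B")
      proof (rule finite_measure_mono)
        have "e / 2 \<le> \<bar>X m \<omega> - L \<omega>\<bar> \<or> e / 2 \<le> \<bar>Y m \<omega> - K \<omega>\<bar>" if "e \<le> \<bar>X m \<omega> + Y m \<omega> - (L \<omega> + K \<omega>)\<bar>" for \<omega>
          using that by linarith
        then show "?A \<subseteq> ?B" by blast
      qed measurable
      also have "\<dots> \<le> ?P m" by (rule measure_Un_le; measurable)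
      finally show ?thesis .
    qed
    then have "\<forall>m. norm (measure M {\<omega>\<in>space M. e \<le> \<bar>X m \<omega> + Y m \<omega> - (L \<omega> + K \<omega>)\<bar>}) \<le> ?P m"
      by simp
    then show ?thesis
      by (rule Lim_null_comparison[OF always_eventually]) (use lim in simp)
  qed
  then show ?thesis unfolding tendsto_in_prob_def by simp
qed

lemma tendsto_in_prob_const:
  assumes "prob_space M" "L \<in> borel_measurable M"
  shows "tendsto_in_prob M (\<lambda>_. L) L"
  using assms unfolding tendsto_in_prob_def by auto

lemma tendsto_in_prob_cmult:
  assumes M: "prob_space M" and X: "tendsto_in_prob M X L"
  shows "tendsto_in_prob M (\<lambda>m \<omega>. c * X m \<omega>) (\<lambda>\<omega>. c * L \<omega>)"
proof (cases "c = 0")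
  case True
  then show ?thesis using tendsto_in_prob_const[OF M, of "\<lambda>_. 0"] by simp
next
  case False
  have [measurable]: "X m \<in> borel_measurable M" "L \<in> borel_measurable M" for m
    using X unfolding tendsto_in_prob_def by auto
  have "e \<le> \<bar>c * X m \<omega> - c * L \<omega>\<bar> \<longleftrightarrow> e / \<bar>c\<bar> \<le> \<bar>X m \<omega> - L \<omega>\<bar>" for e m \<omega>
  proof -
    have "\<bar>c * X m \<omega> - c * L \<omega>\<bar> = \<bar>X m \<omega> - L \<omega>\<bar> * \<bar>c\<bar>"
      by (metis abs_mult mult.commute right_diff_distrib)
    then show ?thesis using False by (simp add: pos_divide_le_eq)
  qed
  then have "(\<lambda>m. measure M {\<omega>\<in>space M. e \<le> \<bar>c * X m \<omega> - c * L \<omega>\<bar>}) \<longlonglongrightarrow> 0" if "0 < e" for e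
    using tendsto_in_probD[OF X, of "e / \<bar>c\<bar>"] that False by simp
  then show ?thesis unfolding tendsto_in_prob_def by simp
qed

lemma tendsto_in_prob_sum:
  assumes M: "prob_space M" and "\<And>i. i \<in> I \<Longrightarrow> tendsto_in_prob M (X i) (L i)"
  shows "tendsto_in_prob M (\<lambda>m \<omega>. \<Sum>i\<in>I. X i m \<omega>) (\<lambda>\<omega>. \<Sum>i\<in>I. L i \<omega>)"
  using assms(2)
proof (induction I rule: infinite_finite_induct)
  case (insert i I)
  then show ?case using tendsto_in_prob_add[OF M, of "X i" "L i"] by simp
qed (auto intro: tendsto_in_prob_const[OF M])

lemma tendsto_in_prob_cong:
  assumes M: "prob_space M" and X: "tendsto_in_prob M X L"
    and Y: "\<And>m. Y m \<in> borel_measurable M" "\<And>m. AE \<omega> in M. X m \<omega> = Y m \<omega>"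
    and K: "K \<in> borel_measurable M" "AE \<omega> in M. L \<omega> = K \<omega>"
  shows "tendsto_in_prob M Y K"
proof -
  interpret prob_space M by fact
  have [measurable]: "X m \<in> borel_measurable M" "L \<in> borel_measurable M"
    "Y m \<in> borel_measurable M" "K \<in> borel_measurable M" for m
    using X Y K unfolding tendsto_in_prob_def by auto
  have "measure M {\<omega>\<in>space M. e \<le> \<bar>X m \<omega> - L \<omega>\<bar>} = measure M {\<omega>\<in>space M. e \<le> \<bar>Y m \<omega> - K \<omega>\<bar>}" for e m
  proof (rule finite_measure_eq_AE)
    show "AE \<omega> in M. \<omega> \<in> {\<omega>\<in>space M. e \<le> \<bar>X m \<omega> - L \<omega>\<bar>}
        \<longleftrightarrow> \<omega> \<in> {\<omega>\<in>space M. e \<le> \<bar>Y m \<omega> - K \<omega>\<bar>}"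
      using Y(2)[of m] K(2) by eventually_elim simp
  qed measurable
  then show ?thesis
    using X unfolding tendsto_in_prob_def by auto
qed

lemma tendsto_in_prob_AE:
  assumes M: "prob_space M" and X: "\<And>m. X m \<in> borel_measurable M" and L: "L \<in> borel_measurable M"
    and lim: "AE \<omega> in M. (\<lambda>m. X m \<omega>) \<longlonglongrightarrow> L \<omega>"
  shows "tendsto_in_prob M X L"
proof -
  interpret prob_space M by fact
  note [measurable] = X L
  have "(\<lambda>m. measure M {\<omega>\<in>space M. e \<le> \<bar>X m \<omega> - L \<omega>\<bar>}) \<longlonglongrightarrow> 0" if e: "0 < e" for e
  proof -
    let ?S = "\<lambda>m. {\<omega>\<in>space M. e \<le> \<bar>X m \<omega> - L \<omega>\<bar>}"
    have "(\<lambda>m. \<integral>\<omega>. indicator (?S m) \<omega> \<partial>M) \<longlonglongrightarrow> (\<integral>\<omega>. (0::real) \<partial>M)"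
    proof (rule integral_dominated_convergence[where w = "\<lambda>_. 1"])
      show "AE \<omega> in M. (\<lambda>m. indicator (?S m) \<omega> :: real) \<longlonglongrightarrow> 0"
        using lim
      proof eventually_elim
        case (elim \<omega>)
        have "\<forall>\<^sub>F m in sequentially. \<bar>X m \<omega> - L \<omega>\<bar> < e"
          using tendstoD[OF elim e] by (simp add: dist_real_def)
        then have "\<forall>\<^sub>F m in sequentially. indicator (?S m) \<omega> = (0::real)"
          by eventually_elim (auto simp: indicator_def)
        then show ?case by (rule tendsto_eventually)
      qed
    qed auto
    then show ?thesis by simp
  qed
  then show ?thesis using X L unfolding tendsto_in_prob_def by auto
qed

section \<open>Stratonovich sums along uniform partitions\<close>

text \<open>
  Every Stratonovich integral is determined by the sums along the partitions of \<open>[0,t]\<close> into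
  equal parts; these partitions are the same for all integrals, which gives linearity and the
  product rule by comparing sums term by term.
\<close>

text \<open>The \<open>k\<close>-th point of the partition of \<open>[0,t]\<close> into \<open>m + 1\<close> equal parts.\<close>

definition unif :: "real \<Rightarrow> nat \<Rightarrow> nat \<Rightarrow> real" where
  "unif t m k = t * real k / real (Suc m)"

text \<open>
  The Stratonovich sum of \<open>X \<circ> dY\<close> over \<open>[0,t]\<close> with \<open>m + 1\<close> steps of equal
  length; \<open>m + 1\<close> rather than \<open>m\<close> so that every \<open>m\<close> gives a partition.
\<close>

definition ssum :: "'w process \<Rightarrow> 'w process \<Rightarrow> real \<Rightarrow> nat \<Rightarrow> 'w \<Rightarrow> real" where
  "ssum X Y t m = strat_sum X Y (unif t m) (Suc m)"

lemma unif_simps [simp]: "unif t m 0 = 0" "unif t m (Suc m) = t"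
  by (simp_all add: unif_def del: of_nat_Suc)

lemma unif_mono: "0 \<le> t \<Longrightarrow> unif t m k \<le> unif t m (Suc k)"
  unfolding unif_def by (intro divide_right_mono mult_left_mono) auto

lemma unif_step: "unif t m (Suc k) - unif t m k = t / real (Suc m)"
  unfolding unif_def diff_divide_distrib[symmetric] by (simp add: algebra_simps)

lemma unif_range:
  assumes "t \<in> {0..T}" "k \<le> Suc m"
  shows "unif t m k \<in> {0..T}"
proof -
  have "t * real k \<le> t * real (Suc m)" using assms by (intro mult_left_mono) auto
  then have "unif t m k \<le> t" unfolding unif_def by (simp add: divide_le_eq)
  moreover have "0 \<le> unif t m k" unfolding unif_def using assms by simp
  ultimately show ?thesis using assms by simp
qed

lemma is_partition_unif: "0 \<le> t \<Longrightarrow> is_partition (unif t m) (Suc m) t"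
  unfolding is_partition_def using unif_mono by simp

lemma ssum_measurable:
  assumes "\<And>s. s \<in> {0..T} \<Longrightarrow> X s \<in> borel_measurable M"
    and "\<And>s. s \<in> {0..T} \<Longrightarrow> Y s \<in> borel_measurable M" and t: "t \<in> {0..T}"
  shows "ssum X Y t m \<in> borel_measurable M"
proof -
  have "X (unif t m k) \<in> borel_measurable M" "Y (unif t m k) \<in> borel_measurable M"
    if "k \<le> Suc m" for k
    using that t by (auto intro!: assms unif_range simp del: atLeastAtMost_iff)
  then show ?thesis
    unfolding ssum_def strat_sum_def
    by (intro borel_measurable_sum borel_measurable_times borel_measurable_divide
        borel_measurable_add borel_measurable_diff) auto
qed

lemma has_strat_integral_ssum:
  assumes J: "has_strat_integral M T X Y J" and t: "t \<in> {0..T}"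
  shows "tendsto_in_prob M (ssum X Y t) (J t)"
  unfolding tendsto_in_prob_def
proof (intro conjI allI impI)
  show "ssum X Y t m \<in> borel_measurable M" for m
    using J t by (intro ssum_measurable) (auto simp: has_strat_integral_def)
  show "J t \<in> borel_measurable M" using J t by (auto simp: has_strat_integral_def)
  fix e :: real assume e: "0 < e"
  show "(\<lambda>m. measure M {\<omega>\<in>space M. e \<le> \<bar>ssum X Y t m \<omega> - J t \<omega>\<bar>}) \<longlonglongrightarrow> 0"
  proof (rule LIMSEQ_I)
    fix q :: real assume q: "0 < q"
    obtain r where r: "0 < r" and P: "\<And>p n. is_partition p n t \<Longrightarrow> \<forall>k<n. p (Suc k) - p k < r \<Longrightarrow>
        measure M {\<omega>\<in>space M. e \<le> \<bar>strat_sum X Y p n \<omega> - J t \<omega>\<bar>} < q"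
      using J t e q unfolding has_strat_integral_def by meson
    obtain n0 where n0: "t / r < real n0" using reals_Archimedean2 by blast
    have "t / real (Suc m) < r" if "n0 \<le> m" for m
    proof -
      have "t < r * real n0" using n0 r by (simp add: divide_less_eq mult.commute)
      also have "\<dots> \<le> r * real (Suc m)" using that r by (intro mult_left_mono) auto
      finally show ?thesis by (simp add: divide_less_eq)
    qed
    then have "norm (measure M {\<omega>\<in>space M. e \<le> \<bar>ssum X Y t m \<omega> - J t \<omega>\<bar>} - 0) < q"
      if "n0 \<le> m" for m
      using that P[OF is_partition_unif, of m] t unfolding ssum_def by (simp add: unif_step)
    then show "\<exists>n0. \<forall>m\<ge>n0. norm (measure M {\<omega>\<in>space M. e \<le> \<bar>ssum X Y t m \<omega> - J t \<omega>\<bar>} - 0) < q"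
      by blast
  qed
qed

lemma ssum_product: "ssum X Y t m \<omega> + ssum Y X t m \<omega> = X t \<omega> * Y t \<omega> - X 0 \<omega> * Y 0 \<omega>"
proof -
  let ?Z = "\<lambda>k. X (unif t m k) \<omega> * Y (unif t m k) \<omega>"
  have "ssum X Y t m \<omega> + ssum Y X t m \<omega> = (\<Sum>k<Suc m. ?Z (Suc k) - ?Z k)"
    unfolding ssum_def strat_sum_def sum.distrib[symmetric]
    by (rule sum.cong) (auto simp: field_simps)
  also have "\<dots> = ?Z (Suc m) - ?Z 0" by (rule sum_lessThan_telescope)
  finally show ?thesis by simp
qed

lemma ssum_add_left: "ssum (\<lambda>s \<omega>. X s \<omega> + X' s \<omega>) Y t m \<omega> = ssum X Y t m \<omega> + ssum X' Y t m \<omega>"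
  unfolding ssum_def strat_sum_def sum.distrib[symmetric]
  by (rule sum.cong) (auto simp: field_simps)

lemma ssum_add_right: "ssum X (\<lambda>s \<omega>. Y s \<omega> + Y' s \<omega>) t m \<omega> = ssum X Y t m \<omega> + ssum X Y' t m \<omega>"
  unfolding ssum_def strat_sum_def sum.distrib[symmetric]
  by (rule sum.cong) (auto simp: field_simps)

lemma ssum_sum_left:
  "ssum (\<lambda>s \<omega>. \<Sum>i\<in>I. X i s \<omega>) Y t m \<omega> = (\<Sum>i\<in>I. ssum (X i) Y t m \<omega>)"
proof (induction I rule: infinite_finite_induct)
  case (insert i I)
  then show ?case using ssum_add_left[of "X i" "\<lambda>s \<omega>. \<Sum>i\<in>I. X i s \<omega>"] by simp
qed (simp_all add: ssum_def strat_sum_def)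

lemma ssum_cmult_left: "ssum (\<lambda>s \<omega>. c * X s \<omega>) Y t m \<omega> = c * ssum X Y t m \<omega>"
  unfolding ssum_def strat_sum_def sum_distrib_left
  by (rule sum.cong) (auto simp: field_simps)

lemma ssum_cmult_right: "ssum X (\<lambda>s \<omega>. c * Y s \<omega>) t m \<omega> = c * ssum X Y t m \<omega>"
  unfolding ssum_def strat_sum_def sum_distrib_left
  by (rule sum.cong) (auto simp: field_simps)

lemma ssum_cong:
  assumes "t \<in> {0..T}" "\<And>s. s \<in> {0..T} \<Longrightarrow> X s \<omega> = X' s \<omega>"
    "\<And>s. s \<in> {0..T} \<Longrightarrow> Y s \<omega> - Y 0 \<omega> = Y' s \<omega> - Y' 0 \<omega>"
  shows "ssum X Y t m \<omega> = ssum X' Y' t m \<omega>"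
  unfolding ssum_def strat_sum_def
proof (rule sum.cong)
  fix k assume "k \<in> {..<Suc m}"
  then have k: "unif t m k \<in> {0..T}" "unif t m (Suc k) \<in> {0..T}"
    using assms(1) by (auto intro!: unif_range simp del: atLeastAtMost_iff)
  have "Y (unif t m (Suc k)) \<omega> - Y (unif t m k) \<omega> = Y' (unif t m (Suc k)) \<omega> - Y' (unif t m k) \<omega>"
    using assms(3)[OF k(1)] assms(3)[OF k(2)] by linarith
  then show "(X (unif t m k) \<omega> + X (unif t m (Suc k)) \<omega>) / 2 * (Y (unif t m (Suc k)) \<omega> - Y (unif t m k) \<omega>)
      = (X' (unif t m k) \<omega> + X' (unif t m (Suc k)) \<omega>) / 2 * (Y' (unif t m (Suc k)) \<omega> - Y' (unif t m k) \<omega>)"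
    using assms(2)[OF k(1)] assms(2)[OF k(2)] by simp
qed simp

lemma ssum_const_right: "ssum X (\<lambda>s. Z) t m \<omega> = 0"
  by (simp add: ssum_def strat_sum_def)

text \<open>For an absolutely continuous integrator the sums converge pathwise.\<close>

lemma ssum_integral:
  assumes t: "t \<in> {0..T}" and f: "continuous_on {0..T} (\<lambda>s. f s \<omega>)"
    and g: "(\<lambda>s. g s \<omega>) absolutely_integrable_on {0..T}"
  shows "(\<lambda>m. ssum f (\<lambda>s \<omega>. integral {0..s} (\<lambda>r. g r \<omega>)) t m \<omega>) \<longlonglongrightarrow> integral {0..t} (\<lambda>r. f r \<omega> * g r \<omega>)"
proof (rule LIMSEQ_I)
  fix e :: real assume e: "0 < e"
  define I where "I = integral {0..T} (\<lambda>r. \<bar>g r \<omega>\<bar>)"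
  have gi: "(\<lambda>r. g r \<omega>) integrable_on {c..d}" and gai: "(\<lambda>r. \<bar>g r \<omega>\<bar>) integrable_on {c..d}"
    and fgi: "(\<lambda>r. f r \<omega> * g r \<omega>) integrable_on {c..d}"
    if "0 \<le> c" "d \<le> T" for c d
  proof -
    have sub: "{c..d} \<subseteq> {0..T}" using that by auto
    have ga: "(\<lambda>r. g r \<omega>) absolutely_integrable_on {c..d}"
      using set_integrable_subset[OF g _ sub] by auto
    then show "(\<lambda>r. g r \<omega>) integrable_on {c..d}" "(\<lambda>r. \<bar>g r \<omega>\<bar>) integrable_on {c..d}"
      unfolding absolutely_integrable_on_def by auto
    have fc: "continuous_on {c..d} (\<lambda>r. f r \<omega>)" using f sub continuous_on_subset by blast
    have "(\<lambda>r. f r \<omega> * g r \<omega>) absolutely_integrable_on {c..d}"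
    proof (rule absolutely_integrable_bounded_measurable_product_real[OF _ _ _ ga])
      show "(\<lambda>r. f r \<omega>) \<in> borel_measurable (lebesgue_on {c..d})"
        by (rule continuous_imp_measurable_on_sets_lebesgue[OF fc]) auto
      show "bounded ((\<lambda>r. f r \<omega>) ` {c..d})"
        using compact_continuous_image[OF fc] compact_imp_bounded by blast
    qed auto
    then show "(\<lambda>r. f r \<omega> * g r \<omega>) integrable_on {c..d}"
      unfolding absolutely_integrable_on_def by auto
  qed
  have I: "0 \<le> I" unfolding I_def by (rule integral_nonneg) (use gai[of 0 T] in auto)
  \<comment> \<open>the error is at most (oscillation of \<open>f\<close> over one step) \<open>\<cdot> I\<close>, and \<open>I\<close> may vanish\<close>
  define q where "q = e / (I + 1)"
  have q: "0 < q" using e I by (simp add: q_def)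
  have "uniformly_continuous_on {0..T} (\<lambda>s. f s \<omega>)"
    using compact_uniformly_continuous[OF f] by simp
  then obtain r where r: "0 < r"
    and fr: "\<And>s s'. s \<in> {0..T} \<Longrightarrow> s' \<in> {0..T} \<Longrightarrow> \<bar>s' - s\<bar> < r \<Longrightarrow> \<bar>f s' \<omega> - f s \<omega>\<bar> < q"
    using q unfolding uniformly_continuous_on_def dist_real_def by meson
  obtain n0 where n0: "t / r < real n0" using reals_Archimedean2 by blast
  have "norm (ssum f (\<lambda>s \<omega>. integral {0..s} (\<lambda>r. g r \<omega>)) t m \<omega>
      - integral {0..t} (\<lambda>r. f r \<omega> * g r \<omega>)) < e" if m: "n0 \<le> m" for m
  proof -
    have "t < r * real n0" using n0 r by (simp add: divide_less_eq mult.commute)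
    also have "\<dots> \<le> r * real (Suc m)" using m r by (intro mult_left_mono) auto
    finally have mesh: "t / real (Suc m) < r" by (simp add: divide_less_eq)
    let ?p = "unif t m"
    let ?c = "\<lambda>k. (f (?p k) \<omega> + f (?p (Suc k)) \<omega>) / 2"
    have rng: "?p k \<in> {0..T}" if "k \<le> Suc m" for k using that t by (auto intro!: unif_range simp del: atLeastAtMost_iff)
    have le: "?p k \<le> ?p (Suc k)" for k using t by (intro unif_mono) auto
    have incr: "integral {0..?p n} \<phi> = (\<Sum>k<n. integral {?p k..?p (Suc k)} \<phi>)"
      if \<phi>: "\<phi> integrable_on {0..T}" and "n \<le> Suc m" for \<phi> :: "real \<Rightarrow> real" and n
      using \<open>n \<le> Suc m\<close>
    proof (induction n)
      case (Suc n)
      have "integral {0..?p n} \<phi> + integral {?p n..?p (Suc n)} \<phi> = integral {0..?p (Suc n)} \<phi>"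
        using rng[of n] rng[of "Suc n"] Suc.prems le
        by (intro Henstock_Kurzweil_Integration.integral_combine)
          (auto intro: integrable_subinterval_real[OF \<phi>])
      with Suc show ?case by simp
    qed simp
    have g1: "(\<lambda>r. g r \<omega>) integrable_on {?p k..?p (Suc k)}" "(\<lambda>r. \<bar>g r \<omega>\<bar>) integrable_on {?p k..?p (Suc k)}"
        "(\<lambda>r. f r \<omega> * g r \<omega>) integrable_on {?p k..?p (Suc k)}" if "k < Suc m" for k
      using rng[of k] rng[of "Suc k"] that by (auto intro!: gi gai fgi)
    have term_le: "\<bar>integral {?p k..?p (Suc k)} (\<lambda>r. (?c k - f r \<omega>) * g r \<omega>)\<bar>
        \<le> q * integral {?p k..?p (Suc k)} (\<lambda>r. \<bar>g r \<omega>\<bar>)" if k: "k < Suc m" for k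
    proof -
      have "norm (integral {?p k..?p (Suc k)} (\<lambda>r. (?c k - f r \<omega>) * g r \<omega>))
          \<le> integral {?p k..?p (Suc k)} (\<lambda>r. q * \<bar>g r \<omega>\<bar>)"
      proof (rule integral_norm_bound_integral)
        show "(\<lambda>r. (?c k - f r \<omega>) * g r \<omega>) integrable_on {?p k..?p (Suc k)}"
          unfolding left_diff_distrib using g1[OF k] by (intro integrable_diff integrable_on_mult_right) auto
        show "(\<lambda>r. q * \<bar>g r \<omega>\<bar>) integrable_on {?p k..?p (Suc k)}"
          using g1[OF k] by (intro integrable_on_mult_right) auto
        fix s assume s: "s \<in> {?p k..?p (Suc k)}"
        have d: "?p (Suc k) - ?p k < r" using mesh by (simp add: unif_step)
        have "\<bar>f (?p k) \<omega> - f s \<omega>\<bar> < q" "\<bar>f (?p (Suc k)) \<omega> - f s \<omega>\<bar> < q"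
          using s d rng[of k] rng[of "Suc k"] k by (auto intro!: fr)
        then have "\<bar>?c k - f s \<omega>\<bar> \<le> q" by (simp add: abs_le_iff abs_less_iff field_simps)
        then show "norm ((?c k - f s \<omega>) * g s \<omega>) \<le> q * \<bar>g s \<omega>\<bar>"
          by (simp add: abs_mult mult_right_mono)
      qed
      then show ?thesis by simp
    qed
    have "ssum f (\<lambda>s \<omega>. integral {0..s} (\<lambda>r. g r \<omega>)) t m \<omega>
        = (\<Sum>k<Suc m. ?c k * integral {?p k..?p (Suc k)} (\<lambda>r. g r \<omega>))"
      unfolding ssum_def strat_sum_def
    proof (rule sum.cong)
      fix k assume k: "k \<in> {..<Suc m}"
      have "integral {0..?p (Suc k)} (\<lambda>r. g r \<omega>) - integral {0..?p k} (\<lambda>r. g r \<omega>)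
          = integral {?p k..?p (Suc k)} (\<lambda>r. g r \<omega>)"
        using incr[of "\<lambda>r. g r \<omega>" k] incr[of "\<lambda>r. g r \<omega>" "Suc k"] k gi[of 0 T] by simp
      then show "?c k * (integral {0..?p (Suc k)} (\<lambda>r. g r \<omega>) - integral {0..?p k} (\<lambda>r. g r \<omega>))
          = ?c k * integral {?p k..?p (Suc k)} (\<lambda>r. g r \<omega>)" by simp
    qed simp
    moreover have "integral {0..t} (\<lambda>r. f r \<omega> * g r \<omega>)
        = (\<Sum>k<Suc m. integral {?p k..?p (Suc k)} (\<lambda>r. f r \<omega> * g r \<omega>))"
      using incr[of "\<lambda>r. f r \<omega> * g r \<omega>" "Suc m"] fgi[of 0 T] by simp
    ultimately have "ssum f (\<lambda>s \<omega>. integral {0..s} (\<lambda>r. g r \<omega>)) t m \<omega>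
        - integral {0..t} (\<lambda>r. f r \<omega> * g r \<omega>)
        = (\<Sum>k<Suc m. ?c k * integral {?p k..?p (Suc k)} (\<lambda>r. g r \<omega>)
            - integral {?p k..?p (Suc k)} (\<lambda>r. f r \<omega> * g r \<omega>))"
      by (simp add: sum_subtractf)
    also have "\<dots> = (\<Sum>k<Suc m. integral {?p k..?p (Suc k)} (\<lambda>r. (?c k - f r \<omega>) * g r \<omega>))"
    proof (rule sum.cong)
      fix k assume k: "k \<in> {..<Suc m}"
      then show "?c k * integral {?p k..?p (Suc k)} (\<lambda>r. g r \<omega>)
            - integral {?p k..?p (Suc k)} (\<lambda>r. f r \<omega> * g r \<omega>)
          = integral {?p k..?p (Suc k)} (\<lambda>r. (?c k - f r \<omega>) * g r \<omega>)"
        unfolding left_diff_distrib using g1[of k]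
        by (subst Henstock_Kurzweil_Integration.integral_diff) (auto intro!: integrable_on_mult_right)
    qed simp
    finally have eq: "ssum f (\<lambda>s \<omega>. integral {0..s} (\<lambda>r. g r \<omega>)) t m \<omega>
        - integral {0..t} (\<lambda>r. f r \<omega> * g r \<omega>)
        = (\<Sum>k<Suc m. integral {?p k..?p (Suc k)} (\<lambda>r. (?c k - f r \<omega>) * g r \<omega>))" .
    have "\<bar>\<dots>\<bar> \<le> (\<Sum>k<Suc m. q * integral {?p k..?p (Suc k)} (\<lambda>r. \<bar>g r \<omega>\<bar>))"
      by (rule order.trans[OF sum_abs], rule sum_mono, rule term_le) auto
    also have "\<dots> = q * integral {0..t} (\<lambda>r. \<bar>g r \<omega>\<bar>)"
      using incr[of "\<lambda>r. \<bar>g r \<omega>\<bar>" "Suc m"] gai[of 0 T] by (simp add: sum_distrib_left distrib_left)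
    also have "\<dots> \<le> q * I"
      unfolding I_def using q t gai[of 0 T] gai[of 0 t]
      by (intro mult_left_mono integral_subset_le) auto
    also have "\<dots> < e"
      using e I by (simp add: q_def divide_simps)
    finally show ?thesis unfolding eq by simp
  qed
  then show "\<exists>n0. \<forall>m\<ge>n0. norm (ssum f (\<lambda>s \<omega>. integral {0..s} (\<lambda>r. g r \<omega>)) t m \<omega>
      - integral {0..t} (\<lambda>r. f r \<omega> * g r \<omega>)) < e" by blast
qed

section \<open>Equality of stochastic differentials\<close>

text \<open>
  An uncountable family of almost sure equalities holds simultaneously if the paths are continuous,
  since a countable dense subset of the parameters suffices.
\<close>

lemma AE_all_if_continuous:
  fixes Z :: "'a::{metric_space, second_countable_topology} \<Rightarrow> 'w \<Rightarrow> real"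
  assumes AE: "\<And>s. s \<in> S \<Longrightarrow> AE \<omega> in M. Z s \<omega> = 0"
    and cont: "\<And>\<omega>. \<omega> \<in> space M \<Longrightarrow> continuous_on S (\<lambda>s. Z s \<omega>)"
  shows "AE \<omega> in M. \<forall>s\<in>S. Z s \<omega> = 0"
proof -
  obtain C where C: "countable C" "C \<subseteq> S" "S \<subseteq> closure C"
    by (rule separable)
  have "AE \<omega> in M. \<forall>s\<in>C. Z s \<omega> = 0"
    using AE C(2) by (intro AE_ball_countable'[OF _ C(1)]) blast
  then show ?thesis
    using AE_space
  proof eventually_elim
    case (elim \<omega>)
    show ?case
    proof
      fix s assume s: "s \<in> S"
      have "closedin (top_of_set S) {x \<in> S. Z x \<omega> = 0}"
        by (rule continuous_closedin_preimage_constant[OF cont[OF elim(2)]])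
      then obtain K where K: "closed K" "{x \<in> S. Z x \<omega> = 0} = S \<inter> K"
        unfolding closedin_closed by meson
      have "C \<subseteq> {x \<in> S. Z x \<omega> = 0}" using C(2) elim(1) by auto
      then have "C \<subseteq> K" unfolding K(2) by simp
      then have "closure C \<subseteq> K" using K(1) by (rule closure_minimal)
      then have "s \<in> {x \<in> S. Z x \<omega> = 0}" unfolding K(2) using s C(3) by auto
      then show "Z s \<omega> = 0" by simp
    qed
  qed
qed

text \<open>
  Stratonovich calculus for the classes \<open>A\<close> of semimartingale fields and \<open>D\<close> of integrands of
  \<open>dt\<close>. Besides closure properties and existence, only associativity of the integral, the
  spatial Leibniz rule and the interchange of \<open>\<partial>\<^sub>i\<close> with \<open>\<integral> dt\<close> are taken from the
  hypothesis; bilinearity, the product rule and the integral against \<open>g dt\<close> are derived below.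
\<close>

locale stratonovich_calculus =
  fixes M :: "'w measure" and F :: "real \<Rightarrow> 'w measure" and T :: real
    and a b :: "real^'d::finite" and A D :: "('d, 'w) field set"
  assumes filtered: "filtered_prob_space M F"
    and T: "0 < T"
    and calculus: "strat_calculus M F T a b A D"
begin

abbreviation S :: "('d, 'w) field \<Rightarrow> ('d, 'w) field \<Rightarrow> ('d, 'w) field" where
  "S \<equiv> sint M T A"

abbreviation deq_field :: "('d, 'w) field \<Rightarrow> ('d, 'w) field \<Rightarrow> bool" (infix \<open>\<doteq>\<close> 50) where
  "f \<doteq> g \<equiv> deq M T f g"

lemma prob_space: "prob_space M"
  using filtered by (simp add: filtered_prob_space_def)

lemma A_const: "(\<lambda>x t \<omega>. c) \<in> A"
  and A_add: "f \<in> A \<Longrightarrow> g \<in> A \<Longrightarrow> (\<lambda>x t \<omega>. f x t \<omega> + g x t \<omega>) \<in> A"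
  and A_mult: "f \<in> A \<Longrightarrow> g \<in> A \<Longrightarrow> (\<lambda>x t \<omega>. f x t \<omega> * g x t \<omega>) \<in> A"
  and A_dx: "f \<in> A \<Longrightarrow> dx i f \<in> A"
  and A_D: "f \<in> A \<Longrightarrow> f \<in> D"
  and A_semimartingale: "f \<in> A \<Longrightarrow> semimartingale_field M F T a b f"
  and A_integral: "f \<in> A \<Longrightarrow> g \<in> A \<Longrightarrow> \<exists>J\<in>A. \<forall>x. has_strat_integral M T (f x) (g x) (J x)"
  and S_assoc: "f \<in> A \<Longrightarrow> g \<in> A \<Longrightarrow> k \<in> A \<Longrightarrow> S f (S g k) \<doteq> S (\<lambda>x t \<omega>. f x t \<omega> * g x t \<omega>) k"
  and dx_S: "f \<in> A \<Longrightarrow> g \<in> A \<Longrightarrow> dx i (S f g) \<doteq> (\<lambda>x t \<omega>. S (dx i f) g x t \<omega> + S f (dx i g) x t \<omega>)"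
  and D_drift: "f \<in> D \<Longrightarrow> drift_field M T a b f"
  and D_add: "f \<in> D \<Longrightarrow> g \<in> D \<Longrightarrow> (\<lambda>x t \<omega>. f x t \<omega> + g x t \<omega>) \<in> D"
  and D_mult: "f \<in> A \<Longrightarrow> g \<in> D \<Longrightarrow> (\<lambda>x t \<omega>. f x t \<omega> * g x t \<omega>) \<in> D"
  and D_dx: "f \<in> D \<Longrightarrow> dx i f \<in> D"
  and A_tint: "f \<in> D \<Longrightarrow> tint f \<in> A"
  and dx_tint: "f \<in> D \<Longrightarrow> dx i (tint f) \<doteq> tint (dx i f)"
  using calculus[unfolded strat_calculus_def] by - (elim conjE; (blast | simp))+

lemma A_S: "f \<in> A \<Longrightarrow> g \<in> A \<Longrightarrow> S f g \<in> A"
  and has_strat_integral_S: "f \<in> A \<Longrightarrow> g \<in> A \<Longrightarrow> has_strat_integral M T (f x) (g x) (S f g x)"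
proof -
  assume "f \<in> A" "g \<in> A"
  then have "\<exists>J. J \<in> A \<and> (\<forall>x. has_strat_integral M T (f x) (g x) (J x))"
    using A_integral by blast
  from someI_ex[OF this]
  show "S f g \<in> A" "has_strat_integral M T (f x) (g x) (S f g x)" by (auto simp: sint_def)
qed

lemma A_cmult: "f \<in> A \<Longrightarrow> (\<lambda>x t \<omega>. c * f x t \<omega>) \<in> A"
  using A_mult[OF A_const] .

lemma A_diff: "f \<in> A \<Longrightarrow> g \<in> A \<Longrightarrow> (\<lambda>x t \<omega>. f x t \<omega> - g x t \<omega>) \<in> A"
  using A_add[of f, OF _ A_cmult[of g "-1"]] by simp

lemma A_sum: "(\<And>i. i \<in> I \<Longrightarrow> f i \<in> A) \<Longrightarrow> (\<lambda>x t \<omega>. \<Sum>i\<in>I. f i x t \<omega>) \<in> A"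
  by (induction I rule: infinite_finite_induct) (simp_all add: A_const A_add)

lemma A_power: "f \<in> A \<Longrightarrow> (\<lambda>x t \<omega>. f x t \<omega> ^ n) \<in> A"
  by (induction n) (simp_all add: A_const A_mult)

lemma A_divide: "f \<in> A \<Longrightarrow> (\<lambda>x t \<omega>. f x t \<omega> / c) \<in> A"
  using A_cmult[of f "inverse c"] by (simp add: divide_inverse mult.commute)

lemma A_dv: "(\<And>i. cmp v i \<in> A) \<Longrightarrow> dv v \<in> A"
  unfolding dv_def by (intro A_sum A_dx)

lemmas A_intros = A_const A_add A_mult A_dx A_S A_diff A_sum A_power A_divide A_dv

lemma D_cmult: "f \<in> D \<Longrightarrow> (\<lambda>x t \<omega>. c * f x t \<omega>) \<in> D"
  using D_mult[OF A_const] .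

lemma D_diff: "f \<in> D \<Longrightarrow> g \<in> D \<Longrightarrow> (\<lambda>x t \<omega>. f x t \<omega> - g x t \<omega>) \<in> D"
  using D_add[of f, OF _ D_cmult[of g "-1"]] by simp

lemma D_sum: "(\<And>i. i \<in> I \<Longrightarrow> f i \<in> D) \<Longrightarrow> (\<lambda>x t \<omega>. \<Sum>i\<in>I. f i x t \<omega>) \<in> D"
  by (induction I rule: infinite_finite_induct) (simp_all add: A_D A_const D_add)

lemma D_dv: "(\<And>i. cmp v i \<in> D) \<Longrightarrow> dv v \<in> D"
  unfolding dv_def by (intro D_sum D_dx)

subsection \<open>Regularity of the fields\<close>

lemma A_measurable: "f \<in> A \<Longrightarrow> t \<in> {0..T} \<Longrightarrow> f x t \<in> borel_measurable M"
proof -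
  assume f: "f \<in> A" and t: "t \<in> {0..T}"
  have "f x t \<in> borel_measurable (F t)"
    using A_semimartingale[OF f] t
    unfolding semimartingale_field_def cont_semimartingale_def adapted_def by blast
  moreover have "subalgebra M (F t)"
    using filtered unfolding filtered_prob_space_def filtration_def subalgebra_def by auto
  ultimately show ?thesis using measurable_from_subalg by blast
qed

lemma A_continuous:
  assumes "f \<in> A" "\<omega> \<in> space M"
  shows "continuous_on (UNIV \<times> {0..T}) (\<lambda>(x, t). f x t \<omega>)"
proof -
  have "\<forall>is. continuous_on (UNIV \<times> {0..T}) (\<lambda>(x, t). foldr pd is (\<lambda>y. f y t \<omega>) x)"
    using A_semimartingale[OF assms(1)] assms(2) unfolding semimartingale_field_def by blast
  from this[rule_format, of "[]"] show ?thesis by simp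
qed

lemma A_continuous_time:
  assumes "f \<in> A" "\<omega> \<in> space M"
  shows "continuous_on {0..T} (\<lambda>t. f x t \<omega>)"
proof -
  have "continuous_on {0..T} ((\<lambda>(x, t). f x t \<omega>) \<circ> Pair x)"
    by (rule continuous_on_compose[OF _ continuous_on_subset[OF A_continuous[OF assms]]])
      (auto intro!: continuous_intros)
  then show ?thesis by (simp add: o_def)
qed

lemma A_continuous_space:
  assumes "f \<in> A" "\<omega> \<in> space M" "t \<in> {0..T}"
  shows "continuous_on UNIV (\<lambda>x. f x t \<omega>)"
proof -
  have "continuous_on UNIV ((\<lambda>(x, t). f x t \<omega>) \<circ> (\<lambda>x. (x, t)))"
    by (rule continuous_on_compose[OF _ continuous_on_subset[OF A_continuous[OF assms(1,2)]]])
      (use assms in \<open>auto intro!: continuous_intros\<close>)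
  then show ?thesis by (simp add: o_def)
qed

lemma D_smooth:
  assumes "f \<in> D" "\<omega> \<in> space M" "t \<in> {0..T}"
  shows "smooth_periodic a b (\<lambda>x. f x t \<omega>)"
  using D_drift[OF assms(1)] assms(2,3) unfolding drift_field_def by blast

lemma D_differentiable:
  assumes "f \<in> D" "\<omega> \<in> space M" "t \<in> {0..T}"
  shows "(\<lambda>x. f x t \<omega>) differentiable (at x)"
proof -
  have "\<forall>is. foldr pd is (\<lambda>x. f x t \<omega>) differentiable_on UNIV"
    using D_smooth[OF assms] unfolding smooth_periodic_def by blast
  from this[rule_format, of "[]"] show ?thesis by (simp add: differentiable_on_def)
qed

lemma D_integrable:
  assumes "f \<in> D" "\<omega> \<in> space M" "t \<in> {0..T}"
  shows "(\<lambda>s. f x s \<omega>) integrable_on {0..t}"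
proof -
  have "(\<lambda>s. f x s \<omega>) integrable_on {0..T}"
    using D_drift[OF assms(1)] assms(2) absolutely_integrable_on_def unfolding drift_field_def by blast
  then show ?thesis by (rule integrable_subinterval_real) (use assms in auto)
qed

subsection \<open>Spatial derivatives\<close>

lemma pd_has_derivative: "(f has_derivative f') (at x) \<Longrightarrow> pd i f x = f' (axis i 1)"
  unfolding pd_def using frechet_derivative_at by metis

lemma D_has_derivative:
  assumes "f \<in> D" "\<omega> \<in> space M" "t \<in> {0..T}"
  shows "((\<lambda>x. f x t \<omega>) has_derivative frechet_derivative (\<lambda>x. f x t \<omega>) (at x)) (at x)"
  using D_differentiable[OF assms] frechet_derivative_works by blast

lemma dx_add:
  assumes "f \<in> D" "g \<in> D" "\<omega> \<in> space M" "t \<in> {0..T}"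
  shows "dx i (\<lambda>x t \<omega>. f x t \<omega> + g x t \<omega>) x t \<omega> = dx i f x t \<omega> + dx i g x t \<omega>"
  unfolding dx_def
  by (subst pd_has_derivative[OF has_derivative_add[OF D_has_derivative D_has_derivative]])
    (use assms in \<open>auto simp: pd_def\<close>)

lemma dx_diff:
  assumes "f \<in> D" "g \<in> D" "\<omega> \<in> space M" "t \<in> {0..T}"
  shows "dx i (\<lambda>x t \<omega>. f x t \<omega> - g x t \<omega>) x t \<omega> = dx i f x t \<omega> - dx i g x t \<omega>"
  unfolding dx_def
  by (subst pd_has_derivative[OF has_derivative_diff[OF D_has_derivative D_has_derivative]])
    (use assms in \<open>auto simp: pd_def\<close>)

lemma dx_cmult:
  assumes "f \<in> D" "\<omega> \<in> space M" "t \<in> {0..T}"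
  shows "dx i (\<lambda>x t \<omega>. c * f x t \<omega>) x t \<omega> = c * dx i f x t \<omega>"
  unfolding dx_def
  by (subst pd_has_derivative[OF has_derivative_mult_right[OF D_has_derivative]])
    (use assms in \<open>auto simp: pd_def\<close>)

lemma dx_mult:
  assumes "f \<in> D" "g \<in> D" "\<omega> \<in> space M" "t \<in> {0..T}"
  shows "dx i (\<lambda>x t \<omega>. f x t \<omega> * g x t \<omega>) x t \<omega> = f x t \<omega> * dx i g x t \<omega> + g x t \<omega> * dx i f x t \<omega>"
  unfolding dx_def
  by (subst pd_has_derivative[OF has_derivative_mult[OF D_has_derivative D_has_derivative]])
    (use assms in \<open>auto simp: pd_def\<close>)

lemma dx_const: "dx i (\<lambda>x t \<omega>. c) x t \<omega> = 0"
  unfolding dx_def pd_def by simp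

subsection \<open>Fields with the same differential\<close>

lemma deqD: "f \<doteq> g \<Longrightarrow> AE \<omega> in M. \<forall>t\<in>{0..T}. f x t \<omega> - f x 0 \<omega> = g x t \<omega> - g x 0 \<omega>"
  by (simp add: deq_def)

lemma deqI: "(\<And>x. AE \<omega> in M. \<forall>t\<in>{0..T}. f x t \<omega> - f x 0 \<omega> = g x t \<omega> - g x 0 \<omega>) \<Longrightarrow> f \<doteq> g"
  by (simp add: deq_def)

lemma deq_refl [simp]: "f \<doteq> f"
  by (simp add: deq_def)

lemma deq_eqI:
  assumes "\<And>x t \<omega>. t \<in> {0..T} \<Longrightarrow> \<omega> \<in> space M \<Longrightarrow> f x t \<omega> = g x t \<omega>"
  shows "f \<doteq> g"
proof (intro deqI AE_I2 ballI)
  fix x t \<omega> assume "\<omega> \<in> space M" "t \<in> {0..T}"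
  moreover from this have "0 \<in> {0..T}" by simp
  ultimately show "f x t \<omega> - f x 0 \<omega> = g x t \<omega> - g x 0 \<omega>" by (simp only: assms)
qed

lemma deq_sym: "f \<doteq> g \<Longrightarrow> g \<doteq> f"
proof (rule deqI)
  fix x assume "f \<doteq> g"
  from deqD[OF this, of x]
  show "AE \<omega> in M. \<forall>t\<in>{0..T}. g x t \<omega> - g x 0 \<omega> = f x t \<omega> - f x 0 \<omega>"
    by (rule eventually_mono) metis
qed

lemma deq_trans [trans]: "f \<doteq> g \<Longrightarrow> g \<doteq> k \<Longrightarrow> f \<doteq> k"
proof (rule deqI)
  fix x assume "f \<doteq> g" "g \<doteq> k"
  from deqD[OF this(1), of x] deqD[OF this(2), of x]
  show "AE \<omega> in M. \<forall>t\<in>{0..T}. f x t \<omega> - f x 0 \<omega> = k x t \<omega> - k x 0 \<omega>"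
    by eventually_elim simp
qed

lemma eq_deq_trans [trans]: "f = g \<Longrightarrow> g \<doteq> k \<Longrightarrow> f \<doteq> k"
  and deq_eq_trans [trans]: "f \<doteq> g \<Longrightarrow> g = k \<Longrightarrow> f \<doteq> k"
  by simp_all

lemma deq_add:
  assumes "f \<doteq> f'" "g \<doteq> g'"
  shows "(\<lambda>x t \<omega>. f x t \<omega> + g x t \<omega>) \<doteq> (\<lambda>x t \<omega>. f' x t \<omega> + g' x t \<omega>)"
proof (rule deqI)
  fix x show "AE \<omega> in M. \<forall>t\<in>{0..T}. f x t \<omega> + g x t \<omega> - (f x 0 \<omega> + g x 0 \<omega>)
      = f' x t \<omega> + g' x t \<omega> - (f' x 0 \<omega> + g' x 0 \<omega>)"
    using deqD[OF assms(1), of x] deqD[OF assms(2), of x]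
    by eventually_elim (simp add: algebra_simps)
qed

lemma deq_cmult:
  assumes "f \<doteq> f'"
  shows "(\<lambda>x t \<omega>. c * f x t \<omega>) \<doteq> (\<lambda>x t \<omega>. c * f' x t \<omega>)"
proof (rule deqI)
  fix x show "AE \<omega> in M. \<forall>t\<in>{0..T}. c * f x t \<omega> - c * f x 0 \<omega> = c * f' x t \<omega> - c * f' x 0 \<omega>"
    using deqD[OF assms(1), of x]
    by eventually_elim (simp add: right_diff_distrib[symmetric])
qed

lemma deq_diff:
  assumes "f \<doteq> f'" "g \<doteq> g'"
  shows "(\<lambda>x t \<omega>. f x t \<omega> - g x t \<omega>) \<doteq> (\<lambda>x t \<omega>. f' x t \<omega> - g' x t \<omega>)"
  using deq_add[OF assms(1) deq_cmult[OF assms(2), of "-1"]] by simp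

lemma deq_sum:
  assumes "\<And>i. i \<in> I \<Longrightarrow> f i \<doteq> g i"
  shows "(\<lambda>x t \<omega>. \<Sum>i\<in>I. f i x t \<omega>) \<doteq> (\<lambda>x t \<omega>. \<Sum>i\<in>I. g i x t \<omega>)"
  using assms
proof (induction I rule: infinite_finite_induct)
  case (insert j I)
  then show ?case using deq_add[of "f j" "g j"] by simp
qed simp_all

text \<open>
  Fields being jointly continuous, an equality of differentials that holds almost surely at each
  point holds almost surely at all points simultaneously.
\<close>

lemma deq_all_points:
  assumes f: "f \<in> A" and g: "g \<in> A" and fg: "f \<doteq> g"
  shows "AE \<omega> in M. \<forall>x. \<forall>t\<in>{0..T}. f x t \<omega> - f x 0 \<omega> = g x t \<omega> - g x 0 \<omega>"
proof -
  let ?Z = "\<lambda>p \<omega>. f (fst p) (snd p) \<omega> - f (fst p) 0 \<omega> - (g (fst p) (snd p) \<omega> - g (fst p) 0 \<omega>)"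
  have "AE \<omega> in M. \<forall>p\<in>UNIV \<times> {0..T}. ?Z p \<omega> = 0"
  proof (rule AE_all_if_continuous)
    fix p assume "p \<in> (UNIV :: (real^'d) set) \<times> {0..T}"
    then show "AE \<omega> in M. ?Z p \<omega> = 0"
      using deqD[OF fg, of "fst p"] by (auto elim!: eventually_mono)
  next
    fix \<omega> assume \<omega>: "\<omega> \<in> space M"
    have *: "continuous_on (UNIV \<times> {0..T}) (\<lambda>p. h (fst p) (snd p) \<omega> - h (fst p) 0 \<omega>)"
      if h: "h \<in> A" for h
    proof (rule continuous_on_diff)
      show "continuous_on (UNIV \<times> {0..T}) (\<lambda>p. h (fst p) (snd p) \<omega>)"
        using A_continuous[OF h \<omega>] by (simp add: case_prod_unfold)
      show "continuous_on (UNIV \<times> {0..T}) (\<lambda>p. h (fst p) 0 \<omega>)"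
        by (rule continuous_on_compose2[OF A_continuous_space[OF h \<omega>]])
          (use T in \<open>auto intro!: continuous_intros\<close>)
    qed
    show "continuous_on (UNIV \<times> {0..T}) (\<lambda>p. ?Z p \<omega>)"
      by (rule continuous_on_diff[OF *[OF f] *[OF g]])
  qed
  then show ?thesis by eventually_elim auto
qed

section \<open>Rules for the Stratonovich integral\<close>

text \<open>
  A differential is determined by the limits in probability of any sequences of approximating
  sums.
\<close>

lemma deqI_limits:
  assumes f: "f \<in> A" and g: "g \<in> A"
    and X: "\<And>x t. t \<in> {0..T} \<Longrightarrow> tendsto_in_prob M (X x t) (\<lambda>\<omega>. f x t \<omega> - f x 0 \<omega>)"
    and Y: "\<And>x t. t \<in> {0..T} \<Longrightarrow> tendsto_in_prob M (Y x t) (\<lambda>\<omega>. g x t \<omega> - g x 0 \<omega>)"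
    and XY: "\<And>x. AE \<omega> in M. \<forall>t\<in>{0..T}. \<forall>m. X x t m \<omega> = Y x t m \<omega>"
  shows "f \<doteq> g"
proof (rule deqI)
  fix x
  let ?Z = "\<lambda>t \<omega>. f x t \<omega> - f x 0 \<omega> - (g x t \<omega> - g x 0 \<omega>)"
  have "AE \<omega> in M. \<forall>t\<in>{0..T}. ?Z t \<omega> = 0"
  proof (rule AE_all_if_continuous)
    fix t assume t: "t \<in> {0..T}"
    note lim = X[OF t, of x] Y[OF t, of x]
    have "tendsto_in_prob M (Y x t) (\<lambda>\<omega>. f x t \<omega> - f x 0 \<omega>)"
    proof (rule tendsto_in_prob_cong[OF prob_space lim(1)])
      show "AE \<omega> in M. X x t m \<omega> = Y x t m \<omega>" for m
        using XY[of x] by (rule eventually_mono) (use t in blast)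
    qed (use tendsto_in_prob_measurable[OF lim(2)] tendsto_in_prob_measurable[OF lim(1)] in auto)
    from tendsto_in_prob_unique[OF prob_space this lim(2)]
    show "AE \<omega> in M. ?Z t \<omega> = 0" by eventually_elim simp
  next
    fix \<omega> assume "\<omega> \<in> space M"
    then show "continuous_on {0..T} (\<lambda>t. ?Z t \<omega>)"
      using A_continuous_time f g by (intro continuous_on_diff continuous_on_const) auto
  qed
  then show "AE \<omega> in M. \<forall>t\<in>{0..T}. f x t \<omega> - f x 0 \<omega> = g x t \<omega> - g x 0 \<omega>"
    by eventually_elim simp
qed

lemma S_initial:
  assumes "f \<in> A" "g \<in> A"
  shows "AE \<omega> in M. S f g x 0 \<omega> = 0"
proof -
  have "tendsto_in_prob M (ssum (f x) (g x) 0) (S f g x 0)"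
    using T by (intro has_strat_integral_ssum[OF has_strat_integral_S[OF assms]]) auto
  moreover have "ssum (f x) (g x) 0 = (\<lambda>_ _. 0)"
    by (intro ext) (simp add: ssum_def strat_sum_def unif_def)
  ultimately have "tendsto_in_prob M (\<lambda>_ _. 0) (S f g x 0)" by simp
  from tendsto_in_prob_unique[OF prob_space this tendsto_in_prob_const[OF prob_space]]
  show ?thesis by auto
qed

lemma S_limit:
  assumes "f \<in> A" "g \<in> A" and t: "t \<in> {0..T}"
  shows "tendsto_in_prob M (ssum (f x) (g x) t) (\<lambda>\<omega>. S f g x t \<omega> - S f g x 0 \<omega>)"
proof (rule tendsto_in_prob_cong[OF prob_space])
  show lim: "tendsto_in_prob M (ssum (f x) (g x) t) (S f g x t)"
    using assms by (intro has_strat_integral_ssum[OF has_strat_integral_S]) auto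
  show "ssum (f x) (g x) t m \<in> borel_measurable M" for m
    using tendsto_in_prob_measurable[OF lim] by auto
  have "0 \<in> {0..T}" using T by simp
  then show "(\<lambda>\<omega>. S f g x t \<omega> - S f g x 0 \<omega>) \<in> borel_measurable M"
    using A_measurable[OF A_S] assms by (intro borel_measurable_diff) auto
  show "AE \<omega> in M. S f g x t \<omega> = S f g x t \<omega> - S f g x 0 \<omega>"
    using S_initial[OF assms(1,2), of x] by eventually_elim simp
qed simp

lemma S_cong:
  assumes A: "f \<in> A" "f' \<in> A" "g \<in> A" "g' \<in> A"
    and f: "\<And>x t \<omega>. t \<in> {0..T} \<Longrightarrow> \<omega> \<in> space M \<Longrightarrow> f x t \<omega> = f' x t \<omega>" and g: "g \<doteq> g'"
  shows "S f g \<doteq> S f' g'"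
proof (rule deqI_limits[OF A_S A_S S_limit S_limit])
  fix x show "AE \<omega> in M. \<forall>t\<in>{0..T}. \<forall>m. ssum (f x) (g x) t m \<omega> = ssum (f' x) (g' x) t m \<omega>"
    using deqD[OF g, of x] AE_space
    by eventually_elim (intro ballI allI ssum_cong, use f in auto)
qed (use A in auto)

lemma S_cong_right: "f \<in> A \<Longrightarrow> g \<in> A \<Longrightarrow> g' \<in> A \<Longrightarrow> g \<doteq> g' \<Longrightarrow> S f g \<doteq> S f g'"
  by (rule S_cong) auto

lemma S_add_left:
  assumes "f \<in> A" "f' \<in> A" "g \<in> A"
  shows "S (\<lambda>x t \<omega>. f x t \<omega> + f' x t \<omega>) g \<doteq> (\<lambda>x t \<omega>. S f g x t \<omega> + S f' g x t \<omega>)"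
proof (rule deqI_limits[where X = "\<lambda>x. ssum (\<lambda>t \<omega>. f x t \<omega> + f' x t \<omega>) (g x)"
      and Y = "\<lambda>x t m \<omega>. ssum (f x) (g x) t m \<omega> + ssum (f' x) (g x) t m \<omega>"])
  fix x t assume t: "t \<in> {0..T}"
  show "tendsto_in_prob M (ssum (\<lambda>t \<omega>. f x t \<omega> + f' x t \<omega>) (g x) t)
      (\<lambda>\<omega>. S (\<lambda>x t \<omega>. f x t \<omega> + f' x t \<omega>) g x t \<omega> - S (\<lambda>x t \<omega>. f x t \<omega> + f' x t \<omega>) g x 0 \<omega>)"
    using S_limit[OF A_add[OF assms(1,2)] assms(3) t, of x] .
  show "tendsto_in_prob M (\<lambda>m \<omega>. ssum (f x) (g x) t m \<omega> + ssum (f' x) (g x) t m \<omega>)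
      (\<lambda>\<omega>. S f g x t \<omega> + S f' g x t \<omega> - (S f g x 0 \<omega> + S f' g x 0 \<omega>))"
    using tendsto_in_prob_add[OF prob_space S_limit S_limit, OF assms(1,3) t assms(2,3) t]
    by (simp add: algebra_simps)
qed (use assms in \<open>auto intro!: A_intros simp: ssum_add_left\<close>)

lemma S_add_right:
  assumes "f \<in> A" "g \<in> A" "g' \<in> A"
  shows "S f (\<lambda>x t \<omega>. g x t \<omega> + g' x t \<omega>) \<doteq> (\<lambda>x t \<omega>. S f g x t \<omega> + S f g' x t \<omega>)"
proof (rule deqI_limits[where X = "\<lambda>x. ssum (f x) (\<lambda>t \<omega>. g x t \<omega> + g' x t \<omega>)"
      and Y = "\<lambda>x t m \<omega>. ssum (f x) (g x) t m \<omega> + ssum (f x) (g' x) t m \<omega>"])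
  fix x t assume t: "t \<in> {0..T}"
  show "tendsto_in_prob M (ssum (f x) (\<lambda>t \<omega>. g x t \<omega> + g' x t \<omega>) t)
      (\<lambda>\<omega>. S f (\<lambda>x t \<omega>. g x t \<omega> + g' x t \<omega>) x t \<omega> - S f (\<lambda>x t \<omega>. g x t \<omega> + g' x t \<omega>) x 0 \<omega>)"
    using S_limit[OF assms(1) A_add[OF assms(2,3)] t, of x] .
  show "tendsto_in_prob M (\<lambda>m \<omega>. ssum (f x) (g x) t m \<omega> + ssum (f x) (g' x) t m \<omega>)
      (\<lambda>\<omega>. S f g x t \<omega> + S f g' x t \<omega> - (S f g x 0 \<omega> + S f g' x 0 \<omega>))"
    using tendsto_in_prob_add[OF prob_space S_limit S_limit, OF assms(1,2) t assms(1,3) t]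
    by (simp add: algebra_simps)
qed (use assms in \<open>auto intro!: A_intros simp: ssum_add_right\<close>)

lemma S_cmult_left:
  assumes "f \<in> A" "g \<in> A"
  shows "S (\<lambda>x t \<omega>. c * f x t \<omega>) g \<doteq> (\<lambda>x t \<omega>. c * S f g x t \<omega>)"
proof (rule deqI_limits[where X = "\<lambda>x. ssum (\<lambda>t \<omega>. c * f x t \<omega>) (g x)"
      and Y = "\<lambda>x t m \<omega>. c * ssum (f x) (g x) t m \<omega>"])
  fix x t assume t: "t \<in> {0..T}"
  show "tendsto_in_prob M (ssum (\<lambda>t \<omega>. c * f x t \<omega>) (g x) t)
      (\<lambda>\<omega>. S (\<lambda>x t \<omega>. c * f x t \<omega>) g x t \<omega> - S (\<lambda>x t \<omega>. c * f x t \<omega>) g x 0 \<omega>)"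
    using S_limit[OF A_cmult[OF assms(1)] assms(2) t, of c x] .
  show "tendsto_in_prob M (\<lambda>m \<omega>. c * ssum (f x) (g x) t m \<omega>)
      (\<lambda>\<omega>. c * S f g x t \<omega> - c * S f g x 0 \<omega>)"
    using tendsto_in_prob_cmult[OF prob_space S_limit, OF assms t] by (simp add: right_diff_distrib)
qed (use assms in \<open>auto intro!: A_intros simp: ssum_cmult_left\<close>)

lemma S_cmult_right:
  assumes "f \<in> A" "g \<in> A"
  shows "S f (\<lambda>x t \<omega>. c * g x t \<omega>) \<doteq> (\<lambda>x t \<omega>. c * S f g x t \<omega>)"
proof (rule deqI_limits[where X = "\<lambda>x. ssum (f x) (\<lambda>t \<omega>. c * g x t \<omega>)"
      and Y = "\<lambda>x t m \<omega>. c * ssum (f x) (g x) t m \<omega>"])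
  fix x t assume t: "t \<in> {0..T}"
  show "tendsto_in_prob M (ssum (f x) (\<lambda>t \<omega>. c * g x t \<omega>) t)
      (\<lambda>\<omega>. S f (\<lambda>x t \<omega>. c * g x t \<omega>) x t \<omega> - S f (\<lambda>x t \<omega>. c * g x t \<omega>) x 0 \<omega>)"
    using S_limit[OF assms(1) A_cmult[OF assms(2)] t, of x c] .
  show "tendsto_in_prob M (\<lambda>m \<omega>. c * ssum (f x) (g x) t m \<omega>)
      (\<lambda>\<omega>. c * S f g x t \<omega> - c * S f g x 0 \<omega>)"
    using tendsto_in_prob_cmult[OF prob_space S_limit, OF assms t] by (simp add: right_diff_distrib)
qed (use assms in \<open>auto intro!: A_intros simp: ssum_cmult_right\<close>)

lemma S_const_right: "f \<in> A \<Longrightarrow> S f (\<lambda>x t \<omega>. c) \<doteq> (\<lambda>x t \<omega>. 0)"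
proof (rule deqI_limits[where X = "\<lambda>x. ssum (f x) (\<lambda>t \<omega>. c)" and Y = "\<lambda>x t m \<omega>. 0"])
  fix x t assume f: "f \<in> A" and t: "t \<in> {0..T}"
  show "tendsto_in_prob M (ssum (f x) (\<lambda>t \<omega>. c) t) (\<lambda>\<omega>. S f (\<lambda>x t \<omega>. c) x t \<omega> - S f (\<lambda>x t \<omega>. c) x 0 \<omega>)"
    using S_limit[OF f A_const t, of x c] .
qed (auto intro!: A_intros tendsto_in_prob_const prob_space simp: ssum_const_right)

lemma S_sum_left:
  assumes "\<And>i. i \<in> I \<Longrightarrow> f i \<in> A" "g \<in> A"
  shows "S (\<lambda>x t \<omega>. \<Sum>i\<in>I. f i x t \<omega>) g \<doteq> (\<lambda>x t \<omega>. \<Sum>i\<in>I. S (f i) g x t \<omega>)"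
  using assms(1)
proof (induction I rule: infinite_finite_induct)
  case (insert j I)
  have "S (\<lambda>x t \<omega>. f j x t \<omega> + (\<Sum>i\<in>I. f i x t \<omega>)) g
      \<doteq> (\<lambda>x t \<omega>. S (f j) g x t \<omega> + S (\<lambda>x t \<omega>. \<Sum>i\<in>I. f i x t \<omega>) g x t \<omega>)"
    using insert.prems assms(2) by (intro S_add_left A_intros) auto
  also have "\<dots> \<doteq> (\<lambda>x t \<omega>. S (f j) g x t \<omega> + (\<Sum>i\<in>I. S (f i) g x t \<omega>))"
    using insert by (intro deq_add deq_refl) auto
  finally show ?case using insert by simp
qed (use S_cmult_left[OF A_const assms(2), of 0 0] in simp_all)

lemma S_sum_right:
  assumes "f \<in> A" "\<And>i. i \<in> I \<Longrightarrow> g i \<in> A"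
  shows "S f (\<lambda>x t \<omega>. \<Sum>i\<in>I. g i x t \<omega>) \<doteq> (\<lambda>x t \<omega>. \<Sum>i\<in>I. S f (g i) x t \<omega>)"
  using assms(2)
proof (induction I rule: infinite_finite_induct)
  case (insert j I)
  have "S f (\<lambda>x t \<omega>. g j x t \<omega> + (\<Sum>i\<in>I. g i x t \<omega>))
      \<doteq> (\<lambda>x t \<omega>. S f (g j) x t \<omega> + S f (\<lambda>x t \<omega>. \<Sum>i\<in>I. g i x t \<omega>) x t \<omega>)"
    using insert.prems assms(1) by (intro S_add_right A_intros) auto
  also have "\<dots> \<doteq> (\<lambda>x t \<omega>. S f (g j) x t \<omega> + (\<Sum>i\<in>I. S f (g i) x t \<omega>))"
    using insert by (intro deq_add deq_refl) auto
  finally show ?case using insert by simp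
qed (use S_const_right[OF assms(1), of 0] in simp_all)

lemma product_rule:
  assumes "f \<in> A" "g \<in> A"
  shows "(\<lambda>x t \<omega>. f x t \<omega> * g x t \<omega>) \<doteq> (\<lambda>x t \<omega>. S f g x t \<omega> + S g f x t \<omega>)"
proof (rule deqI_limits[where X = "\<lambda>x t m \<omega>. f x t \<omega> * g x t \<omega> - f x 0 \<omega> * g x 0 \<omega>"
      and Y = "\<lambda>x t m \<omega>. ssum (f x) (g x) t m \<omega> + ssum (g x) (f x) t m \<omega>"])
  fix x t assume t: "t \<in> {0..T}"
  have 0: "0 \<in> {0..T}" using T by simp
  show "tendsto_in_prob M (\<lambda>m \<omega>. f x t \<omega> * g x t \<omega> - f x 0 \<omega> * g x 0 \<omega>)
      (\<lambda>\<omega>. f x t \<omega> * g x t \<omega> - f x 0 \<omega> * g x 0 \<omega>)"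
    using assms t 0 by (intro tendsto_in_prob_const prob_space borel_measurable_diff
        borel_measurable_times A_measurable) auto
  show "tendsto_in_prob M (\<lambda>m \<omega>. ssum (f x) (g x) t m \<omega> + ssum (g x) (f x) t m \<omega>)
      (\<lambda>\<omega>. S f g x t \<omega> + S g f x t \<omega> - (S f g x 0 \<omega> + S g f x 0 \<omega>))"
    using tendsto_in_prob_add[OF prob_space S_limit S_limit, OF assms t assms(2,1) t]
    by (simp add: algebra_simps)
qed (use assms in \<open>auto intro!: A_intros simp: ssum_product\<close>)

text \<open>Against \<open>g dt\<close> the Stratonovich integral is the ordinary time integral.\<close>

lemma S_tint:
  assumes f: "f \<in> A" and g: "g \<in> D"
  shows "S f (tint g) \<doteq> tint (\<lambda>x t \<omega>. f x t \<omega> * g x t \<omega>)"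
proof (rule deqI_limits[where X = "\<lambda>x. ssum (f x) (tint g x)" and Y = "\<lambda>x. ssum (f x) (tint g x)"])
  fix x t assume t: "t \<in> {0..T}"
  show "tendsto_in_prob M (ssum (f x) (tint g x) t) (\<lambda>\<omega>. S f (tint g) x t \<omega> - S f (tint g) x 0 \<omega>)"
    by (rule S_limit[OF f A_tint[OF g] t])
  have fg: "tint (\<lambda>x t \<omega>. f x t \<omega> * g x t \<omega>) \<in> A" by (intro A_tint D_mult f g)
  show "tendsto_in_prob M (ssum (f x) (tint g x) t)
      (\<lambda>\<omega>. tint (\<lambda>x t \<omega>. f x t \<omega> * g x t \<omega>) x t \<omega> - tint (\<lambda>x t \<omega>. f x t \<omega> * g x t \<omega>) x 0 \<omega>)"
  proof (rule tendsto_in_prob_AE[OF prob_space])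
    show "ssum (f x) (tint g x) t m \<in> borel_measurable M" for m
      using t by (intro ssum_measurable[OF A_measurable[OF f] A_measurable[OF A_tint[OF g]]])
    have "0 \<in> {0..T}" using T by simp
    then show "(\<lambda>\<omega>. tint (\<lambda>x t \<omega>. f x t \<omega> * g x t \<omega>) x t \<omega> - tint (\<lambda>x t \<omega>. f x t \<omega> * g x t \<omega>) x 0 \<omega>)
        \<in> borel_measurable M"
      using t by (intro borel_measurable_diff A_measurable[OF fg])
    show "AE \<omega> in M. (\<lambda>m. ssum (f x) (tint g x) t m \<omega>)
        \<longlonglongrightarrow> tint (\<lambda>x t \<omega>. f x t \<omega> * g x t \<omega>) x t \<omega> - tint (\<lambda>x t \<omega>. f x t \<omega> * g x t \<omega>) x 0 \<omega>"
    proof (rule AE_I2)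
      fix \<omega> assume \<omega>: "\<omega> \<in> space M"
      have "(\<lambda>s. g x s \<omega>) absolutely_integrable_on {0..T}"
        using D_drift[OF g] \<omega> unfolding drift_field_def by blast
      from ssum_integral[where f = "f x" and g = "g x" and \<omega> = \<omega>, OF t A_continuous_time[OF f \<omega>] this]
      show "(\<lambda>m. ssum (f x) (tint g x) t m \<omega>)
          \<longlonglongrightarrow> tint (\<lambda>x t \<omega>. f x t \<omega> * g x t \<omega>) x t \<omega> - tint (\<lambda>x t \<omega>. f x t \<omega> * g x t \<omega>) x 0 \<omega>"
        unfolding tint_def by simp
    qed
  qed
qed (use f g in \<open>auto intro: A_S A_tint D_mult\<close>)

subsection \<open>Time integrals\<close>

lemma tint_cong:
  assumes "\<And>x t \<omega>. t \<in> {0..T} \<Longrightarrow> \<omega> \<in> space M \<Longrightarrow> f x t \<omega> = g x t \<omega>"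
  shows "tint f \<doteq> tint g"
  unfolding tint_def
  by (rule deq_eqI, rule Henstock_Kurzweil_Integration.integral_cong) (use assms in auto)

lemma tint_add:
  assumes "f \<in> D" "g \<in> D"
  shows "tint (\<lambda>x t \<omega>. f x t \<omega> + g x t \<omega>) \<doteq> (\<lambda>x t \<omega>. tint f x t \<omega> + tint g x t \<omega>)"
  unfolding tint_def
  by (rule deq_eqI, rule Henstock_Kurzweil_Integration.integral_add) (use assms D_integrable in auto)

lemma tint_cmult: "tint (\<lambda>x t \<omega>. c * f x t \<omega>) = (\<lambda>x t \<omega>. c * tint f x t \<omega>)"
  unfolding tint_def by simp

lemma tint_sum:
  assumes "finite I" "\<And>i. i \<in> I \<Longrightarrow> f i \<in> D"
  shows "tint (\<lambda>x t \<omega>. \<Sum>i\<in>I. f i x t \<omega>) \<doteq> (\<lambda>x t \<omega>. \<Sum>i\<in>I. tint (f i) x t \<omega>)"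
  unfolding tint_def
  by (rule deq_eqI, rule Henstock_Kurzweil_Integration.integral_sum) (use assms D_integrable in auto)

section \<open>Advection by a stochastic flow\<close>

abbreviation fprod :: "('d, 'w) field \<Rightarrow> ('d, 'w) field \<Rightarrow> ('d, 'w) field" (infixl \<open>\<odot>\<close> 70) where
  "f \<odot> g \<equiv> \<lambda>x t \<omega>. f x t \<omega> * g x t \<omega>"

text \<open>
  The field whose differential is \<open>d\<^sub>t f + \<Sum>\<^sub>i \<partial>\<^sub>i f \<circ> dV\<^sub>i\<close>: the material
  derivative of \<open>f\<close> along the stochastic displacement \<open>dV\<close>.
\<close>

definition adv :: "('d \<Rightarrow> ('d, 'w) field) \<Rightarrow> ('d, 'w) field \<Rightarrow> ('d, 'w) field" where
  "adv V f = (\<lambda>x t \<omega>. f x t \<omega> + (\<Sum>i\<in>UNIV. S (dx i f) (V i) x t \<omega>))"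

lemma A_adv: "(\<And>i. V i \<in> A) \<Longrightarrow> f \<in> A \<Longrightarrow> adv V f \<in> A"
  unfolding adv_def by (intro A_intros)

lemma S_assoc_eq:
  assumes "f \<in> A" "g \<in> A" "k \<in> A" "l \<in> A"
    and "\<And>x t \<omega>. t \<in> {0..T} \<Longrightarrow> \<omega> \<in> space M \<Longrightarrow> f x t \<omega> * g x t \<omega> = l x t \<omega>"
  shows "S f (S g k) \<doteq> S l k"
proof -
  have "S f (S g k) \<doteq> S (f \<odot> g) k" using assms by (intro S_assoc)
  also have "\<dots> \<doteq> S l k" using assms by (intro S_cong A_mult) auto
  finally show ?thesis .
qed

lemma adv_add:
  assumes V: "\<And>i. V i \<in> A" and f: "f \<in> A" and g: "g \<in> A"
  shows "adv V (\<lambda>x t \<omega>. f x t \<omega> + g x t \<omega>) \<doteq> (\<lambda>x t \<omega>. adv V f x t \<omega> + adv V g x t \<omega>)"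
proof -
  have "S (dx i (\<lambda>x t \<omega>. f x t \<omega> + g x t \<omega>)) (V i)
      \<doteq> (\<lambda>x t \<omega>. S (dx i f) (V i) x t \<omega> + S (dx i g) (V i) x t \<omega>)" for i
  proof -
    have "S (dx i (\<lambda>x t \<omega>. f x t \<omega> + g x t \<omega>)) (V i)
        \<doteq> S (\<lambda>x t \<omega>. dx i f x t \<omega> + dx i g x t \<omega>) (V i)"
      by (intro S_cong A_intros V f g dx_add A_D deq_refl)
    also have "\<dots> \<doteq> (\<lambda>x t \<omega>. S (dx i f) (V i) x t \<omega> + S (dx i g) (V i) x t \<omega>)"
      by (intro S_add_left A_intros V f g)
    finally show ?thesis .
  qed
  then have "adv V (\<lambda>x t \<omega>. f x t \<omega> + g x t \<omega>) \<doteq> (\<lambda>x t \<omega>. f x t \<omega> + g x t \<omega>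
      + (\<Sum>i\<in>UNIV. S (dx i f) (V i) x t \<omega> + S (dx i g) (V i) x t \<omega>))"
    unfolding adv_def by (intro deq_add deq_refl deq_sum)
  then show ?thesis by (simp add: adv_def sum.distrib algebra_simps)
qed

lemma adv_cmult:
  assumes V: "\<And>i. V i \<in> A" and f: "f \<in> A"
  shows "adv V (\<lambda>x t \<omega>. c * f x t \<omega>) \<doteq> (\<lambda>x t \<omega>. c * adv V f x t \<omega>)"
proof -
  have "S (dx i (\<lambda>x t \<omega>. c * f x t \<omega>)) (V i) \<doteq> (\<lambda>x t \<omega>. c * S (dx i f) (V i) x t \<omega>)" for i
  proof -
    have "S (dx i (\<lambda>x t \<omega>. c * f x t \<omega>)) (V i) \<doteq> S (\<lambda>x t \<omega>. c * dx i f x t \<omega>) (V i)"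
      by (intro S_cong A_intros V f dx_cmult A_D deq_refl)
    also have "\<dots> \<doteq> (\<lambda>x t \<omega>. c * S (dx i f) (V i) x t \<omega>)"
      by (intro S_cmult_left A_intros V f)
    finally show ?thesis .
  qed
  then have "adv V (\<lambda>x t \<omega>. c * f x t \<omega>) \<doteq> (\<lambda>x t \<omega>. c * f x t \<omega>
      + (\<Sum>i\<in>UNIV. c * S (dx i f) (V i) x t \<omega>))"
    unfolding adv_def by (intro deq_add deq_refl deq_sum)
  then show ?thesis by (simp add: adv_def sum_distrib_left distrib_left)
qed

lemma adv_const: "(\<And>i. V i \<in> A) \<Longrightarrow> adv V (\<lambda>x t \<omega>. c) \<doteq> (\<lambda>x t \<omega>. 0)"
proof -
  assume V: "\<And>i. V i \<in> A"
  have "adv V (\<lambda>x t \<omega>. 0 * c) \<doteq> (\<lambda>x t \<omega>. 0 * adv V (\<lambda>x t \<omega>. c) x t \<omega>)"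
    by (intro adv_cmult V A_const)
  then have 0: "adv V (\<lambda>x t \<omega>. 0) \<doteq> (\<lambda>x t \<omega>. 0)" by simp
  have "dx i (\<lambda>x t \<omega>. c) = (dx i (\<lambda>x t \<omega>. 0) :: ('d, 'w) field)" for i
    by (intro ext) (simp add: dx_const)
  then have "adv V (\<lambda>x t \<omega>. c) = (\<lambda>x t \<omega>. c + adv V (\<lambda>x t \<omega>. 0) x t \<omega>)"
    unfolding adv_def by (simp only: add_0_left)
  also have "\<dots> \<doteq> (\<lambda>x t \<omega>. c + 0)" by (intro deq_add 0 deq_refl)
  also have "\<dots> \<doteq> (\<lambda>x t \<omega>. 0)" by (simp add: deq_def)
  finally show ?thesis .
qed

lemma adv_sum:
  assumes V: "\<And>i. V i \<in> A" and f: "\<And>j. j \<in> I \<Longrightarrow> f j \<in> A"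
  shows "adv V (\<lambda>x t \<omega>. \<Sum>j\<in>I. f j x t \<omega>) \<doteq> (\<lambda>x t \<omega>. \<Sum>j\<in>I. adv V (f j) x t \<omega>)"
  using f
proof (induction I rule: infinite_finite_induct)
  case (insert j I)
  have "adv V (\<lambda>x t \<omega>. f j x t \<omega> + (\<Sum>j\<in>I. f j x t \<omega>))
      \<doteq> (\<lambda>x t \<omega>. adv V (f j) x t \<omega> + adv V (\<lambda>x t \<omega>. \<Sum>j\<in>I. f j x t \<omega>) x t \<omega>)"
    using insert.prems by (intro adv_add V A_sum) auto
  also have "\<dots> \<doteq> (\<lambda>x t \<omega>. adv V (f j) x t \<omega> + (\<Sum>j\<in>I. adv V (f j) x t \<omega>))"
    using insert by (intro deq_add deq_refl) auto
  finally show ?case using insert by simp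
qed (simp_all add: adv_const[OF V])

lemma S_adv:
  assumes V: "\<And>i. V i \<in> A" and f: "f \<in> A" and g: "g \<in> A"
  shows "S f (adv V g) \<doteq> (\<lambda>x t \<omega>. S f g x t \<omega> + (\<Sum>i\<in>UNIV. S (f \<odot> dx i g) (V i) x t \<omega>))"
proof -
  have "S f (adv V g) \<doteq> (\<lambda>x t \<omega>. S f g x t \<omega> + S f (\<lambda>x t \<omega>. \<Sum>i\<in>UNIV. S (dx i g) (V i) x t \<omega>) x t \<omega>)"
    unfolding adv_def by (intro S_add_right A_intros V f g)
  also have "\<dots> \<doteq> (\<lambda>x t \<omega>. S f g x t \<omega> + (\<Sum>i\<in>UNIV. S f (S (dx i g) (V i)) x t \<omega>))"
    by (intro deq_add deq_refl S_sum_right A_intros V f g)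
  also have "\<dots> \<doteq> (\<lambda>x t \<omega>. S f g x t \<omega> + (\<Sum>i\<in>UNIV. S (f \<odot> dx i g) (V i) x t \<omega>))"
    by (intro deq_add deq_refl deq_sum S_assoc A_intros V f g)
  finally show ?thesis .
qed

lemma S_dx_mult:
  assumes f: "f \<in> A" and g: "g \<in> A" and k: "k \<in> A"
  shows "S (dx i (f \<odot> g)) k \<doteq> (\<lambda>x t \<omega>. S (f \<odot> dx i g) k x t \<omega> + S (g \<odot> dx i f) k x t \<omega>)"
proof -
  have "S (dx i (f \<odot> g)) k \<doteq> S (\<lambda>x t \<omega>. f x t \<omega> * dx i g x t \<omega> + g x t \<omega> * dx i f x t \<omega>) k"
    by (intro S_cong A_intros f g k deq_refl dx_mult A_D)
  also have "\<dots> \<doteq> (\<lambda>x t \<omega>. S (f \<odot> dx i g) k x t \<omega> + S (g \<odot> dx i f) k x t \<omega>)"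
    by (intro S_add_left A_intros f g k)
  finally show ?thesis .
qed

lemma adv_mult:
  assumes V: "\<And>i. V i \<in> A" and f: "f \<in> A" and g: "g \<in> A"
  shows "adv V (f \<odot> g) \<doteq> (\<lambda>x t \<omega>. S f (adv V g) x t \<omega> + S g (adv V f) x t \<omega>)"
proof -
  have "adv V (f \<odot> g) \<doteq> (\<lambda>x t \<omega>. (S f g x t \<omega> + S g f x t \<omega>)
      + (\<Sum>i\<in>UNIV. S (f \<odot> dx i g) (V i) x t \<omega> + S (g \<odot> dx i f) (V i) x t \<omega>))"
    unfolding adv_def by (intro deq_add deq_sum product_rule S_dx_mult V f g)
  also have "\<dots> = (\<lambda>x t \<omega>. (S f g x t \<omega> + (\<Sum>i\<in>UNIV. S (f \<odot> dx i g) (V i) x t \<omega>))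
      + (S g f x t \<omega> + (\<Sum>i\<in>UNIV. S (g \<odot> dx i f) (V i) x t \<omega>)))"
    by (simp add: sum.distrib algebra_simps)
  also have "\<dots> \<doteq> (\<lambda>x t \<omega>. S f (adv V g) x t \<omega> + S g (adv V f) x t \<omega>)"
    by (intro deq_add deq_sym[OF S_adv] V f g)
  finally show ?thesis .
qed

text \<open>
  If \<open>h\<close> satisfies the continuity equation \<open>D h + h \<circ> div dV = 0\<close>, then
  \<open>d(h f) + div (h f \<circ> dV) = h \<circ> D f\<close>.
\<close>

lemma adv_conservative:
  assumes V: "\<And>i. V i \<in> A" and h: "h \<in> A" and f: "f \<in> A"
    and mass: "(\<lambda>x t \<omega>. adv V h x t \<omega> + S h (\<lambda>x t \<omega>. \<Sum>i\<in>UNIV. dx i (V i) x t \<omega>) x t \<omega>) \<doteq> (\<lambda>x t \<omega>. 0)"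
  shows "(\<lambda>x t \<omega>. h x t \<omega> * f x t \<omega> + (\<Sum>i\<in>UNIV. dx i (S (h \<odot> f) (V i)) x t \<omega>)) \<doteq> S h (adv V f)"
proof -
  let ?div = "\<lambda>x t \<omega>. \<Sum>i\<in>UNIV. dx i (V i) x t \<omega>"
  have flux: "dx i (S (h \<odot> f) (V i)) \<doteq> (\<lambda>x t \<omega>. (S (h \<odot> dx i f) (V i) x t \<omega>
      + S (f \<odot> dx i h) (V i) x t \<omega>) + S f (S h (dx i (V i))) x t \<omega>)" for i
  proof -
    have "dx i (S (h \<odot> f) (V i)) \<doteq> (\<lambda>x t \<omega>. S (dx i (h \<odot> f)) (V i) x t \<omega> + S (h \<odot> f) (dx i (V i)) x t \<omega>)"
      by (intro dx_S A_intros V h f)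
    also have "\<dots> \<doteq> (\<lambda>x t \<omega>. (S (h \<odot> dx i f) (V i) x t \<omega>
        + S (f \<odot> dx i h) (V i) x t \<omega>) + S f (S h (dx i (V i))) x t \<omega>)"
      by (intro deq_add S_dx_mult deq_sym[OF S_assoc_eq] V f h A_intros) auto
    finally show ?thesis .
  qed
  have fluxes: "(\<lambda>x t \<omega>. \<Sum>i\<in>UNIV. dx i (S (h \<odot> f) (V i)) x t \<omega>) \<doteq> (\<lambda>x t \<omega>. \<Sum>i\<in>UNIV.
      (S (h \<odot> dx i f) (V i) x t \<omega> + S (f \<odot> dx i h) (V i) x t \<omega>) + S f (S h (dx i (V i))) x t \<omega>)"
    by (intro deq_sum flux)
  have "S f (S h ?div) \<doteq> S f (\<lambda>x t \<omega>. \<Sum>i\<in>UNIV. S h (dx i (V i)) x t \<omega>)"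
    by (intro S_cong_right S_sum_right A_intros V f h)
  also have "\<dots> \<doteq> (\<lambda>x t \<omega>. \<Sum>i\<in>UNIV. S f (S h (dx i (V i))) x t \<omega>)"
    by (intro S_sum_right A_intros V f h)
  finally have div: "S f (S h ?div) \<doteq> (\<lambda>x t \<omega>. \<Sum>i\<in>UNIV. S f (S h (dx i (V i))) x t \<omega>)" .
  have "S f (\<lambda>x t \<omega>. adv V h x t \<omega> + S h ?div x t \<omega>) \<doteq> S f (\<lambda>x t \<omega>. 0)"
    by (intro S_cong_right mass A_intros A_adv V f h)
  also have "\<dots> \<doteq> (\<lambda>x t \<omega>. 0)" by (intro S_const_right f)
  finally have mass': "S f (\<lambda>x t \<omega>. adv V h x t \<omega> + S h ?div x t \<omega>) \<doteq> (\<lambda>x t \<omega>. 0)" .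
  have split: "S f (\<lambda>x t \<omega>. adv V h x t \<omega> + S h ?div x t \<omega>)
      \<doteq> (\<lambda>x t \<omega>. S f (adv V h) x t \<omega> + S f (S h ?div) x t \<omega>)"
    by (intro S_add_right A_intros A_adv V f h)
  show ?thesis
  proof (rule deqI)
    fix x
    show "AE \<omega> in M. \<forall>t\<in>{0..T}.
        h x t \<omega> * f x t \<omega> + (\<Sum>i\<in>UNIV. dx i (S (h \<odot> f) (V i)) x t \<omega>)
          - (h x 0 \<omega> * f x 0 \<omega> + (\<Sum>i\<in>UNIV. dx i (S (h \<odot> f) (V i)) x 0 \<omega>))
        = S h (adv V f) x t \<omega> - S h (adv V f) x 0 \<omega>"
      using deqD[OF product_rule[OF h f], of x] deqD[OF fluxes, of x]
        deqD[OF S_adv[of V, OF V h f], of x] deqD[OF S_adv[of V, OF V f h], of x]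
        deqD[OF div, of x] deqD[OF mass', of x] deqD[OF split, of x]
    proof eventually_elim
      case (elim \<omega>)
      show ?case
      proof
        fix t assume t: "t \<in> {0..T}"
        note E = elim[THEN bspec, OF t]
        show "h x t \<omega> * f x t \<omega> + (\<Sum>i\<in>UNIV. dx i (S (h \<odot> f) (V i)) x t \<omega>)
          - (h x 0 \<omega> * f x 0 \<omega> + (\<Sum>i\<in>UNIV. dx i (S (h \<odot> f) (V i)) x 0 \<omega>))
          = S h (adv V f) x t \<omega> - S h (adv V f) x 0 \<omega>"
          using E unfolding sum.distrib by linarith
      qed
    qed
  qed
qed

section \<open>Local conservation of energy\<close>

text \<open>
  The displacement \<open>dV\<close> has divergence \<open>\<epsilon> w dt\<close> with \<open>w = div u\<close>, which is what remains
  when noise and drift are divergence free. The constant \<open>c\<close> stands for \<open>\<epsilon> \<beta>\<^sup>2\<close>, and \<open>r\<close>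
  for \<open>1 / h\<close>.
\<close>

lemma local_energy_law:
  fixes h \<eta> r G w K e :: "('d, 'w) field" and u V :: "'d \<Rightarrow> ('d, 'w) field" and \<epsilon> c :: real
  assumes w_def: "w = (\<lambda>x t \<omega>. \<Sum>i\<in>UNIV. dx i (u i) x t \<omega>)"
    and K_def: "K = S (\<lambda>x t \<omega>. h x t \<omega> ^ 3 / 3) G"
    and e_def: "e = (\<lambda>x t \<omega>. h x t \<omega> * (\<epsilon>\<^sup>2 / 2 * (\<Sum>j\<in>UNIV. u j x t \<omega> * u j x t \<omega>) + 1 / 2 * h x t \<omega>
      + \<epsilon>\<^sup>2 * c / 6 * ((h x t \<omega> * w x t \<omega>) * (h x t \<omega> * w x t \<omega>))))"
    and V: "\<And>i. V i \<in> A" and h: "h \<in> A" and \<eta>: "\<eta> \<in> A" and r: "r \<in> A" and G: "G \<in> A"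
    and u: "\<And>j. u j \<in> A"
    and hr: "\<And>x t \<omega>. t \<in> {0..T} \<Longrightarrow> \<omega> \<in> space M \<Longrightarrow> h x t \<omega> * r x t \<omega> = 1"
    and h\<eta>: "\<And>j x t \<omega>. t \<in> {0..T} \<Longrightarrow> \<omega> \<in> space M \<Longrightarrow> dx j h x t \<omega> = \<epsilon> * dx j \<eta> x t \<omega>"
    and divV: "(\<lambda>x t \<omega>. \<Sum>i\<in>UNIV. dx i (V i) x t \<omega>) \<doteq> (\<lambda>x t \<omega>. \<epsilon> * tint w x t \<omega>)"
    and mass: "adv V h \<doteq> (\<lambda>x t \<omega>. - \<epsilon> * tint (h \<odot> w) x t \<omega>)"
    and GD: "G \<doteq> (\<lambda>x t \<omega>. adv V w x t \<omega> - \<epsilon> * tint (w \<odot> w) x t \<omega>)"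
    and momentum: "\<And>j. (\<lambda>x t \<omega>. adv V (u j) x t \<omega> + tint (dx j \<eta>) x t \<omega> - c * S r (dx j K) x t \<omega>)
      \<doteq> (\<lambda>x t \<omega>. 0)"
  shows "\<exists>\<Phi>. (\<forall>j. \<Phi> j \<in> A) \<and> e \<doteq> (\<lambda>x t \<omega>. \<Sum>j\<in>UNIV. dx j (\<Phi> j) x t \<omega>)"
proof -
  have w: "w \<in> A" unfolding w_def by (intro A_intros u)
  have K: "K \<in> A" unfolding K_def by (intro A_intros h G)
  have e: "e \<in> A" unfolding e_def by (intro A_intros h u w)
  let ?q = "h \<odot> w"
  let ?f = "\<lambda>x t \<omega>. \<epsilon>\<^sup>2 / 2 * (\<Sum>j\<in>UNIV. u j x t \<omega> * u j x t \<omega>) + 1 / 2 * h x t \<omega>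
      + \<epsilon>\<^sup>2 * c / 6 * ((h x t \<omega> * w x t \<omega>) * (h x t \<omega> * w x t \<omega>))"
  have f: "?f \<in> A" by (intro A_intros h u w)
  note fields = V h \<eta> r G u w K e f

  have S_tint_cmult: "S k (\<lambda>x t \<omega>. s * tint g x t \<omega>) \<doteq> (\<lambda>x t \<omega>. s * tint (k \<odot> g) x t \<omega>)"
    if "k \<in> A" "g \<in> D" for k g s
  proof -
    have "S k (\<lambda>x t \<omega>. s * tint g x t \<omega>) \<doteq> (\<lambda>x t \<omega>. s * S k (tint g) x t \<omega>)"
      using that by (intro S_cmult_right A_tint)
    also have "\<dots> \<doteq> (\<lambda>x t \<omega>. s * tint (k \<odot> g) x t \<omega>)"
      using that by (intro deq_cmult S_tint)
    finally show ?thesis .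
  qed
  \<comment> \<open>the continuity equation makes \<open>de + div (e dV)\<close> equal to \<open>h\<close> times the material derivative\<close>
  \<comment> \<open>of the energy per unit mass\<close>
  have balance: "(\<lambda>x t \<omega>. e x t \<omega> + (\<Sum>i\<in>UNIV. dx i (S e (V i)) x t \<omega>)) \<doteq> S h (adv V ?f)"
    unfolding e_def
  proof (rule adv_conservative[OF V h f])
    have "S h (\<lambda>x t \<omega>. \<Sum>i\<in>UNIV. dx i (V i) x t \<omega>) \<doteq> S h (\<lambda>x t \<omega>. \<epsilon> * tint w x t \<omega>)"
      by (intro S_cong_right divV A_intros A_tint A_D fields)
    also have "\<dots> \<doteq> (\<lambda>x t \<omega>. \<epsilon> * tint (h \<odot> w) x t \<omega>)"
      by (intro S_tint_cmult A_D fields)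
    finally have "(\<lambda>x t \<omega>. adv V h x t \<omega> + S h (\<lambda>x t \<omega>. \<Sum>i\<in>UNIV. dx i (V i) x t \<omega>) x t \<omega>)
        \<doteq> (\<lambda>x t \<omega>. - \<epsilon> * tint (h \<odot> w) x t \<omega> + \<epsilon> * tint (h \<odot> w) x t \<omega>)"
      by (intro deq_add mass)
    then show "(\<lambda>x t \<omega>. adv V h x t \<omega> + S h (\<lambda>x t \<omega>. \<Sum>i\<in>UNIV. dx i (V i) x t \<omega>) x t \<omega>)
        \<doteq> (\<lambda>x t \<omega>. 0)" by simp
  qed

  \<comment> \<open>the quantity \<open>h w\<close> absorbs the term \<open>- \<epsilon> w\<^sup>2 dt\<close> of \<open>dG\<close>\<close>
  have adv_q: "adv V ?q \<doteq> S h G"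
  proof -
    have 1: "S w (adv V h) \<doteq> (\<lambda>x t \<omega>. - \<epsilon> * tint (h \<odot> (w \<odot> w)) x t \<omega>)"
    proof -
      have "S w (adv V h) \<doteq> S w (\<lambda>x t \<omega>. - \<epsilon> * tint (h \<odot> w) x t \<omega>)"
        by (intro S_cong_right mass A_adv A_intros A_tint A_D fields)
      also have "\<dots> \<doteq> (\<lambda>x t \<omega>. - \<epsilon> * tint (w \<odot> (h \<odot> w)) x t \<omega>)"
        by (intro S_tint_cmult A_intros A_D fields)
      finally show ?thesis by (simp add: mult_ac)
    qed
    have "S h G \<doteq> S h (\<lambda>x t \<omega>. adv V w x t \<omega> + - \<epsilon> * tint (w \<odot> w) x t \<omega>)"
      using GD by (intro S_cong_right A_adv A_intros A_tint A_D fields) simp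
    also have "\<dots> \<doteq> (\<lambda>x t \<omega>. S h (adv V w) x t \<omega> + S h (\<lambda>x t \<omega>. - \<epsilon> * tint (w \<odot> w) x t \<omega>) x t \<omega>)"
      by (intro S_add_right A_adv A_intros A_tint A_D fields)
    also have "\<dots> \<doteq> (\<lambda>x t \<omega>. S h (adv V w) x t \<omega> + - \<epsilon> * tint (h \<odot> (w \<odot> w)) x t \<omega>)"
      by (intro deq_add deq_refl S_tint_cmult A_intros A_D fields)
    also have "\<dots> \<doteq> (\<lambda>x t \<omega>. S h (adv V w) x t \<omega> + S w (adv V h) x t \<omega>)"
      by (intro deq_add deq_refl deq_sym[OF 1])
    also have "\<dots> \<doteq> adv V ?q"
      by (intro deq_sym[OF adv_mult] fields)
    finally show ?thesis by (rule deq_sym)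
  qed
  have S_adv_qq: "S h (adv V (?q \<odot> ?q)) \<doteq> (\<lambda>x t \<omega>. 6 * (\<Sum>j\<in>UNIV. S (dx j (u j)) K x t \<omega>))"
  proof -
    have "S h (adv V (?q \<odot> ?q)) \<doteq> S h (\<lambda>x t \<omega>. S ?q (adv V ?q) x t \<omega> + S ?q (adv V ?q) x t \<omega>)"
      by (intro S_cong_right adv_mult A_adv A_intros fields)
    also have "\<dots> \<doteq> S h (\<lambda>x t \<omega>. S ?q (S h G) x t \<omega> + S ?q (S h G) x t \<omega>)"
      by (intro S_cong_right deq_add adv_q A_adv A_intros fields)
    also have "\<dots> \<doteq> (\<lambda>x t \<omega>. S h (S ?q (S h G)) x t \<omega> + S h (S ?q (S h G)) x t \<omega>)"
      by (intro S_add_right A_intros fields)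
    also have "\<dots> = (\<lambda>x t \<omega>. 2 * S h (S ?q (S h G)) x t \<omega>)" by simp
    also have "\<dots> \<doteq> (\<lambda>x t \<omega>. 2 * S (\<lambda>x t \<omega>. 3 * w x t \<omega>) K x t \<omega>)"
    proof (rule deq_cmult)
      have "S h (S ?q (S h G)) \<doteq> S (h \<odot> ?q) (S h G)"
        by (intro S_assoc A_intros fields)
      also have "\<dots> \<doteq> S ((h \<odot> ?q) \<odot> h) G"
        by (intro S_assoc A_intros fields)
      also have "\<dots> \<doteq> S (\<lambda>x t \<omega>. 3 * w x t \<omega>) K"
        unfolding K_def
        by (intro deq_sym[OF S_assoc_eq] A_intros fields) (simp add: power3_eq_cube)
      finally show "S h (S ?q (S h G)) \<doteq> S (\<lambda>x t \<omega>. 3 * w x t \<omega>) K" .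
    qed
    also have "\<dots> \<doteq> (\<lambda>x t \<omega>. 2 * (3 * S w K x t \<omega>))"
      by (intro deq_cmult S_cmult_left fields)
    also have "\<dots> \<doteq> (\<lambda>x t \<omega>. 2 * (3 * (\<Sum>j\<in>UNIV. S (dx j (u j)) K x t \<omega>)))"
      unfolding w_def by (intro deq_cmult S_sum_left A_intros fields)
    finally show ?thesis by simp
  qed

  \<comment> \<open>kinetic energy: the momentum equation tested with \<open>h u\<^sub>j\<close>\<close>
  have S_adv_uu: "S h (adv V (u j \<odot> u j))
      \<doteq> (\<lambda>x t \<omega>. 2 * (c * S (u j) (dx j K) x t \<omega> - tint ((h \<odot> u j) \<odot> dx j \<eta>) x t \<omega>))" for j
  proof -
    let ?p = "h \<odot> u j"
    have "S h (adv V (u j \<odot> u j)) \<doteq> S h (\<lambda>x t \<omega>. S (u j) (adv V (u j)) x t \<omega> + S (u j) (adv V (u j)) x t \<omega>)"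
      by (intro S_cong_right adv_mult A_adv A_intros fields)
    also have "\<dots> \<doteq> (\<lambda>x t \<omega>. S h (S (u j) (adv V (u j))) x t \<omega> + S h (S (u j) (adv V (u j))) x t \<omega>)"
      by (intro S_add_right A_adv A_intros fields)
    also have "\<dots> = (\<lambda>x t \<omega>. 2 * S h (S (u j) (adv V (u j))) x t \<omega>)" by simp
    also have "\<dots> \<doteq> (\<lambda>x t \<omega>. 2 * S ?p (adv V (u j)) x t \<omega>)"
      by (intro deq_cmult S_assoc A_adv fields)
    also have "\<dots> \<doteq> (\<lambda>x t \<omega>. 2 * (c * S (u j) (dx j K) x t \<omega> - tint (?p \<odot> dx j \<eta>) x t \<omega>))"
    proof (rule deq_cmult)
      have "adv V (u j) \<doteq> (\<lambda>x t \<omega>. c * S r (dx j K) x t \<omega> + -1 * tint (dx j \<eta>) x t \<omega>)"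
      proof (rule deqI)
        fix x
        show "AE \<omega> in M. \<forall>t\<in>{0..T}. adv V (u j) x t \<omega> - adv V (u j) x 0 \<omega>
            = c * S r (dx j K) x t \<omega> + -1 * tint (dx j \<eta>) x t \<omega>
              - (c * S r (dx j K) x 0 \<omega> + -1 * tint (dx j \<eta>) x 0 \<omega>)"
          using deqD[OF momentum[of j], of x] by (rule eventually_mono) (simp add: algebra_simps)
      qed
      then have "S ?p (adv V (u j)) \<doteq> S ?p (\<lambda>x t \<omega>. c * S r (dx j K) x t \<omega> + -1 * tint (dx j \<eta>) x t \<omega>)"
        by (intro S_cong_right A_adv A_intros A_tint A_D fields)
      also have "\<dots> \<doteq> (\<lambda>x t \<omega>. S ?p (\<lambda>x t \<omega>. c * S r (dx j K) x t \<omega>) x t \<omega>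
          + S ?p (\<lambda>x t \<omega>. -1 * tint (dx j \<eta>) x t \<omega>) x t \<omega>)"
        by (intro S_add_right A_intros A_tint A_D fields)
      also have "\<dots> \<doteq> (\<lambda>x t \<omega>. c * S ?p (S r (dx j K)) x t \<omega> + -1 * tint (?p \<odot> dx j \<eta>) x t \<omega>)"
        by (intro deq_add S_cmult_right S_tint_cmult A_intros A_D fields)
      also have "\<dots> \<doteq> (\<lambda>x t \<omega>. c * S (u j) (dx j K) x t \<omega> + -1 * tint (?p \<odot> dx j \<eta>) x t \<omega>)"
      proof (intro deq_add deq_cmult deq_refl S_assoc_eq A_intros fields)
        fix x t \<omega> assume "t \<in> {0..T}" "\<omega> \<in> space M"
        from hr[OF this, of x] show "h x t \<omega> * u j x t \<omega> * r x t \<omega> = u j x t \<omega>"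
          by (simp add: mult_ac)
      qed
      finally show "S ?p (adv V (u j)) \<doteq> (\<lambda>x t \<omega>. c * S (u j) (dx j K) x t \<omega> - tint (?p \<odot> dx j \<eta>) x t \<omega>)"
        by simp
    qed
    finally show ?thesis .
  qed
  have S_adv_h: "S h (adv V h) \<doteq> (\<lambda>x t \<omega>. - \<epsilon> * tint (h \<odot> (h \<odot> w)) x t \<omega>)"
  proof -
    have "S h (adv V h) \<doteq> S h (\<lambda>x t \<omega>. - \<epsilon> * tint (h \<odot> w) x t \<omega>)"
      by (intro S_cong_right mass A_adv A_intros A_tint A_D fields)
    also have "\<dots> \<doteq> (\<lambda>x t \<omega>. - \<epsilon> * tint (h \<odot> (h \<odot> w)) x t \<omega>)"
      by (intro S_tint_cmult A_intros A_D fields)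
    finally show ?thesis .
  qed

  have rhs: "S h (adv V ?f) \<doteq> (\<lambda>x t \<omega>.
      \<epsilon>\<^sup>2 / 2 * (\<Sum>j\<in>UNIV. 2 * (c * S (u j) (dx j K) x t \<omega> - tint ((h \<odot> u j) \<odot> dx j \<eta>) x t \<omega>))
      + 1 / 2 * (- \<epsilon> * tint (h \<odot> (h \<odot> w)) x t \<omega>)
      + \<epsilon>\<^sup>2 * c / 6 * (6 * (\<Sum>j\<in>UNIV. S (dx j (u j)) K x t \<omega>)))"
  proof -
    have "adv V ?f \<doteq> (\<lambda>x t \<omega>.
        adv V (\<lambda>x t \<omega>. \<epsilon>\<^sup>2 / 2 * (\<Sum>j\<in>UNIV. u j x t \<omega> * u j x t \<omega>) + 1 / 2 * h x t \<omega>) x t \<omega>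
        + adv V (\<lambda>x t \<omega>. \<epsilon>\<^sup>2 * c / 6 * ((h x t \<omega> * w x t \<omega>) * (h x t \<omega> * w x t \<omega>))) x t \<omega>)"
      by (intro adv_add A_intros fields)
    also have "\<dots> \<doteq> (\<lambda>x t \<omega>.
        (adv V (\<lambda>x t \<omega>. \<epsilon>\<^sup>2 / 2 * (\<Sum>j\<in>UNIV. u j x t \<omega> * u j x t \<omega>)) x t \<omega>
         + adv V (\<lambda>x t \<omega>. 1 / 2 * h x t \<omega>) x t \<omega>)
        + adv V (\<lambda>x t \<omega>. \<epsilon>\<^sup>2 * c / 6 * ((h x t \<omega> * w x t \<omega>) * (h x t \<omega> * w x t \<omega>))) x t \<omega>)"
      by (intro deq_add deq_refl adv_add A_intros fields)
    also have "\<dots> \<doteq> (\<lambda>x t \<omega>.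
        (\<epsilon>\<^sup>2 / 2 * adv V (\<lambda>x t \<omega>. \<Sum>j\<in>UNIV. u j x t \<omega> * u j x t \<omega>) x t \<omega> + 1 / 2 * adv V h x t \<omega>)
        + \<epsilon>\<^sup>2 * c / 6 * adv V (?q \<odot> ?q) x t \<omega>)"
      by (intro deq_add adv_cmult A_intros fields)
    also have "\<dots> \<doteq> (\<lambda>x t \<omega>.
        (\<epsilon>\<^sup>2 / 2 * (\<Sum>j\<in>UNIV. adv V (u j \<odot> u j) x t \<omega>) + 1 / 2 * adv V h x t \<omega>)
        + \<epsilon>\<^sup>2 * c / 6 * adv V (?q \<odot> ?q) x t \<omega>)"
      by (intro deq_add deq_cmult deq_refl adv_sum A_intros fields)
    finally have "S h (adv V ?f) \<doteq> S h (\<lambda>x t \<omega>.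
        (\<epsilon>\<^sup>2 / 2 * (\<Sum>j\<in>UNIV. adv V (u j \<odot> u j) x t \<omega>) + 1 / 2 * adv V h x t \<omega>)
        + \<epsilon>\<^sup>2 * c / 6 * adv V (?q \<odot> ?q) x t \<omega>)"
      by (intro S_cong_right A_adv A_intros fields)
    also have "\<dots> \<doteq> (\<lambda>x t \<omega>. S h (\<lambda>x t \<omega>. \<epsilon>\<^sup>2 / 2 * (\<Sum>j\<in>UNIV. adv V (u j \<odot> u j) x t \<omega>)
          + 1 / 2 * adv V h x t \<omega>) x t \<omega>
        + S h (\<lambda>x t \<omega>. \<epsilon>\<^sup>2 * c / 6 * adv V (?q \<odot> ?q) x t \<omega>) x t \<omega>)"
      by (intro S_add_right A_adv A_intros fields)
    also have "\<dots> \<doteq> (\<lambda>x t \<omega>. (S h (\<lambda>x t \<omega>. \<epsilon>\<^sup>2 / 2 * (\<Sum>j\<in>UNIV. adv V (u j \<odot> u j) x t \<omega>)) x t \<omega>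
          + S h (\<lambda>x t \<omega>. 1 / 2 * adv V h x t \<omega>) x t \<omega>)
        + S h (\<lambda>x t \<omega>. \<epsilon>\<^sup>2 * c / 6 * adv V (?q \<odot> ?q) x t \<omega>) x t \<omega>)"
      by (intro deq_add deq_refl S_add_right A_adv A_intros fields)
    also have "\<dots> \<doteq> (\<lambda>x t \<omega>. (\<epsilon>\<^sup>2 / 2 * S h (\<lambda>x t \<omega>. \<Sum>j\<in>UNIV. adv V (u j \<odot> u j) x t \<omega>) x t \<omega>
          + 1 / 2 * S h (adv V h) x t \<omega>)
        + \<epsilon>\<^sup>2 * c / 6 * S h (adv V (?q \<odot> ?q)) x t \<omega>)"
      by (intro deq_add S_cmult_right A_adv A_intros fields)
    also have "\<dots> \<doteq> (\<lambda>x t \<omega>. (\<epsilon>\<^sup>2 / 2 * (\<Sum>j\<in>UNIV. S h (adv V (u j \<odot> u j)) x t \<omega>)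
          + 1 / 2 * S h (adv V h) x t \<omega>)
        + \<epsilon>\<^sup>2 * c / 6 * S h (adv V (?q \<odot> ?q)) x t \<omega>)"
      by (intro deq_add deq_cmult deq_refl S_sum_right A_adv A_intros fields)
    also have "\<dots> \<doteq> (\<lambda>x t \<omega>.
        (\<epsilon>\<^sup>2 / 2 * (\<Sum>j\<in>UNIV. 2 * (c * S (u j) (dx j K) x t \<omega> - tint ((h \<odot> u j) \<odot> dx j \<eta>) x t \<omega>))
         + 1 / 2 * (- \<epsilon> * tint (h \<odot> (h \<odot> w)) x t \<omega>))
        + \<epsilon>\<^sup>2 * c / 6 * (6 * (\<Sum>j\<in>UNIV. S (dx j (u j)) K x t \<omega>)))"
      by (intro deq_add deq_cmult deq_sum S_adv_uu S_adv_h S_adv_qq)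
    finally show ?thesis .
  qed

  \<comment> \<open>the pressure and dispersive terms are divergences as well\<close>
  define P where "P j = (h \<odot> h) \<odot> u j" for j
  have P: "P j \<in> A" for j unfolding P_def by (intro A_intros fields)
  have dP: "dx j (tint (P j)) \<doteq> (\<lambda>x t \<omega>. tint ((h \<odot> h) \<odot> dx j (u j)) x t \<omega>
      + 2 * \<epsilon> * tint ((h \<odot> u j) \<odot> dx j \<eta>) x t \<omega>)" for j
  proof -
    have "dx j (tint (P j)) \<doteq> tint (dx j (P j))" by (intro dx_tint A_D P)
    also have "\<dots> \<doteq> tint (\<lambda>x t \<omega>. h x t \<omega> * h x t \<omega> * dx j (u j) x t \<omega>
        + 2 * \<epsilon> * (h x t \<omega> * u j x t \<omega> * dx j \<eta> x t \<omega>))"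
    proof (rule tint_cong)
      fix x t \<omega> assume *: "t \<in> {0..T}" "\<omega> \<in> space M"
      have "dx j (P j) x t \<omega> = h x t \<omega> * h x t \<omega> * dx j (u j) x t \<omega>
          + u j x t \<omega> * (h x t \<omega> * dx j h x t \<omega> + h x t \<omega> * dx j h x t \<omega>)"
        unfolding P_def using * by (simp add: dx_mult A_D A_mult fields)
      then show "dx j (P j) x t \<omega> = h x t \<omega> * h x t \<omega> * dx j (u j) x t \<omega>
          + 2 * \<epsilon> * (h x t \<omega> * u j x t \<omega> * dx j \<eta> x t \<omega>)"
        using h\<eta>[OF *] by (simp add: algebra_simps)
    qed
    also have "\<dots> \<doteq> (\<lambda>x t \<omega>. tint ((h \<odot> h) \<odot> dx j (u j)) x t \<omega>
        + tint (\<lambda>x t \<omega>. 2 * \<epsilon> * (h x t \<omega> * u j x t \<omega> * dx j \<eta> x t \<omega>)) x t \<omega>)"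
      by (intro tint_add A_D A_intros fields)
    finally show ?thesis by (simp add: tint_cmult)
  qed
  have tint_w: "tint (h \<odot> (h \<odot> w)) \<doteq> (\<lambda>x t \<omega>. \<Sum>j\<in>UNIV. tint ((h \<odot> h) \<odot> dx j (u j)) x t \<omega>)"
  proof -
    have "tint (h \<odot> (h \<odot> w)) = tint (\<lambda>x t \<omega>. \<Sum>j\<in>UNIV. h x t \<omega> * h x t \<omega> * dx j (u j) x t \<omega>)"
      by (simp add: w_def sum_distrib_left mult.assoc)
    also have "\<dots> \<doteq> (\<lambda>x t \<omega>. \<Sum>j\<in>UNIV. tint ((h \<odot> h) \<odot> dx j (u j)) x t \<omega>)"
      by (intro tint_sum A_D A_intros fields) simp
    finally show ?thesis .
  qed
  have dK: "dx j (S (u j) K) \<doteq> (\<lambda>x t \<omega>. S (dx j (u j)) K x t \<omega> + S (u j) (dx j K) x t \<omega>)" for j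
    by (intro dx_S fields)
  \<comment> \<open>minus the energy flux: dispersion, advection of energy, and work of the hydrostatic pressure\<close>
  define \<Phi> where "\<Phi> j = (\<lambda>x t \<omega>. \<epsilon>\<^sup>2 * c * S (u j) K x t \<omega> - (S e (V j) x t \<omega> + \<epsilon> / 2 * tint (P j) x t \<omega>))" for j
  have \<Phi>: "\<Phi> j \<in> A" for j unfolding \<Phi>_def by (intro A_intros A_tint A_D P fields)
  have d\<Phi>: "dx j (\<Phi> j) \<doteq> (\<lambda>x t \<omega>. \<epsilon>\<^sup>2 * c * dx j (S (u j) K) x t \<omega>
      - (dx j (S e (V j)) x t \<omega> + \<epsilon> / 2 * dx j (tint (P j)) x t \<omega>))" for j
  proof (rule deq_eqI)
    fix x t \<omega> assume *: "t \<in> {0..T}" "\<omega> \<in> space M"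
    show "dx j (\<Phi> j) x t \<omega> = \<epsilon>\<^sup>2 * c * dx j (S (u j) K) x t \<omega>
        - (dx j (S e (V j)) x t \<omega> + \<epsilon> / 2 * dx j (tint (P j)) x t \<omega>)"
    proof -
      have 1: "(\<lambda>x t \<omega>. \<epsilon>\<^sup>2 * c * S (u j) K x t \<omega>) \<in> D" "S e (V j) \<in> D" "tint (P j) \<in> D"
        "(\<lambda>x t \<omega>. \<epsilon> / 2 * tint (P j) x t \<omega>) \<in> D"
        "(\<lambda>x t \<omega>. S e (V j) x t \<omega> + \<epsilon> / 2 * tint (P j) x t \<omega>) \<in> D" "S (u j) K \<in> D"
        by (intro A_D A_intros A_tint P fields)+
      show ?thesis
        unfolding \<Phi>_def dx_diff[OF 1(1,5) *(2,1)] dx_add[OF 1(2,4) *(2,1)]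
          dx_cmult[OF 1(3) *(2,1)] dx_cmult[OF 1(6) *(2,1)] ..
    qed
  qed
  note sum_d\<Phi> = deq_sum[where I = UNIV and f = "\<lambda>j. dx j (\<Phi> j)", OF d\<Phi>]
  note sum_dP = deq_sum[where I = UNIV and f = "\<lambda>j. dx j (tint (P j))", OF dP]
  note sum_dK = deq_sum[where I = UNIV and f = "\<lambda>j. dx j (S (u j) K)", OF dK]
  have "e \<doteq> (\<lambda>x t \<omega>. \<Sum>j\<in>UNIV. dx j (\<Phi> j) x t \<omega>)"
  proof (rule deqI)
    fix x
    let ?rhs = "\<lambda>t \<omega>. \<Sum>j\<in>UNIV. dx j (\<Phi> j) x t \<omega>"
    show "AE \<omega> in M. \<forall>t\<in>{0..T}. e x t \<omega> - e x 0 \<omega> = ?rhs t \<omega> - ?rhs 0 \<omega>"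
      using deqD[OF balance, of x] deqD[OF rhs, of x] deqD[OF tint_w, of x]
        deqD[OF sum_d\<Phi>, of x] deqD[OF sum_dP, of x] deqD[OF sum_dK, of x]
    proof eventually_elim
      case (elim \<omega>)
      show ?case
      proof
        fix t assume t: "t \<in> {0..T}"
        note E = elim[THEN bspec, OF t]
        show "e x t \<omega> - e x 0 \<omega> = ?rhs t \<omega> - ?rhs 0 \<omega>"
          using E unfolding sum.distrib sum_subtractf sum_distrib_left[symmetric] 
          by algebra
      qed
    qed
  qed
  with \<Phi> show ?thesis by blast
qed

end

section \<open>Integrals over the periodic cell\<close>

text \<open>
  The box extended by \<open>s\<close> in direction \<open>i\<close> is cut once into the cell and a slab on its
  right, and once into a slab on the left and the translated cell; the two slabs differ by a full
  period.
\<close>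

lemma integral_periodic_shift:
  fixes g :: "real^'d::finite \<Rightarrow> real"
  assumes g: "continuous_on UNIV g" and s: "0 \<le> s" "s \<le> b $ i - a $ i"
    and per: "\<And>x. g (x + (b $ i - a $ i) *\<^sub>R axis i 1) = g x"
  shows "integral (cbox a b) (\<lambda>x. g (x + s *\<^sub>R axis i 1)) = integral (cbox a b) g"
proof -
  define e :: "real^'d" where "e = axis i 1"
  define L where "L = b $ i - a $ i"
  have e: "e \<in> Basis" by (simp add: e_def)
  have ej: "e $ j = (if j = i then 1 else 0)" for j by (auto simp: e_def axis_def)
  have xe: "x \<bullet> e = x $ i" for x by (simp add: e_def inner_axis)
  have shift: "integral (cbox p q) (\<lambda>x. g (x + r *\<^sub>R e)) = integral (cbox (p + r *\<^sub>R e) (q + r *\<^sub>R e)) g" for p q r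
    using integral_shift_cbox_plus[of p q g "r *\<^sub>R e"] by (simp add: o_def add.commute)
  have int: "g integrable_on cbox p q" for p q
    by (rule integrable_continuous[OF continuous_on_subset[OF g]]) simp
  let ?Q = "cbox a (b + s *\<^sub>R e)"
  have Q1: "?Q \<inter> {x. x \<bullet> e \<le> b $ i} = cbox a b"
    using s unfolding xe by (auto simp: mem_box_cart ej split: if_splits; smt (verit))
  have Q2: "?Q \<inter> {x. x \<bullet> e \<ge> b $ i} = cbox (a + L *\<^sub>R e) (b + s *\<^sub>R e)"
    using s unfolding xe L_def by (auto simp: mem_box_cart ej split: if_splits; smt (verit))
  have Q3: "?Q \<inter> {x. x \<bullet> e \<le> a $ i + s} = cbox a (b + (s - L) *\<^sub>R e)"
    using s unfolding xe L_def by (auto simp: mem_box_cart ej split: if_splits; smt (verit))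
  have Q4: "?Q \<inter> {x. x \<bullet> e \<ge> a $ i + s} = cbox (a + s *\<^sub>R e) (b + s *\<^sub>R e)"
    using s unfolding xe L_def by (auto simp: mem_box_cart ej split: if_splits; smt (verit))
  have "integral (cbox a b) g + integral (cbox (a + L *\<^sub>R e) (b + s *\<^sub>R e)) g
      = integral (cbox a (b + (s - L) *\<^sub>R e)) g + integral (cbox (a + s *\<^sub>R e) (b + s *\<^sub>R e)) g"
    using integral_split[OF int e, of a "b + s *\<^sub>R e" "b $ i"]
      integral_split[OF int e, of a "b + s *\<^sub>R e" "a $ i + s"] unfolding Q1 Q2 Q3 Q4 by simp
  moreover have "integral (cbox (a + L *\<^sub>R e) (b + s *\<^sub>R e)) g = integral (cbox a (b + (s - L) *\<^sub>R e)) g"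
  proof -
    have "b + s *\<^sub>R e = b + (s - L) *\<^sub>R e + L *\<^sub>R e" by (simp add: algebra_simps)
    then have "integral (cbox (a + L *\<^sub>R e) (b + s *\<^sub>R e)) g
        = integral (cbox a (b + (s - L) *\<^sub>R e)) (\<lambda>x. g (x + L *\<^sub>R e))"
      by (simp only: shift)
    then show ?thesis using per by (simp add: L_def e_def)
  qed
  ultimately have "integral (cbox (a + s *\<^sub>R e) (b + s *\<^sub>R e)) g = integral (cbox a b) g" by simp
  then show ?thesis using shift[of a b s] by (simp add: e_def)
qed

text \<open>
  The fundamental theorem of calculus along a full period gives 0 on every line parallel to the
  \<open>i\<close>-th axis; by Fubini the integral of \<open>\<partial>\<^sub>i f\<close> over the cell, averaged over all
  translates of the cell in this direction, vanishes, and all translates contribute equally.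
\<close>

lemma integral_pd_periodic:
  fixes f :: "real^'d::finite \<Rightarrow> real"
  assumes f: "smooth_periodic a b f" and ab: "a $ i < b $ i"
  shows "integral (cbox a b) (pd i f) = 0"
proof -
  define e :: "real^'d" where "e = axis i 1"
  define L where "L = b $ i - a $ i"
  have L: "0 < L" using ab by (simp add: L_def)
  have smooth: "foldr pd is f differentiable_on UNIV" for "is"
    using f by (simp add: smooth_periodic_def)
  have per: "f (x + L *\<^sub>R e) = f x" for x
    using f by (simp add: smooth_periodic_def L_def e_def)
  have fd: "(f has_derivative frechet_derivative f (at x)) (at x)" for x
    using smooth[of "[]"] frechet_derivative_works by (auto simp: differentiable_on_def)
  have gc: "continuous_on UNIV (pd i f)"
    using differentiable_imp_continuous_on[OF smooth[of "[i]"]] by simp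
  have gper: "pd i f (x + L *\<^sub>R e) = pd i f x" for x
  proof -
    have "((\<lambda>x. f (x + L *\<^sub>R e)) has_derivative frechet_derivative f (at (x + L *\<^sub>R e))) (at x)"
      by (rule has_derivative_compose[where f = "\<lambda>x. x + L *\<^sub>R e" and f' = "\<lambda>v. v", OF _ fd])
        (auto intro!: derivative_eq_intros)
    then have "(f has_derivative frechet_derivative f (at (x + L *\<^sub>R e))) (at x)" by (simp add: per)
    then have "frechet_derivative f (at (x + L *\<^sub>R e)) = frechet_derivative f (at x)"
      by (rule frechet_derivative_at)
    then show ?thesis by (simp add: pd_def)
  qed
  have line: "integral {0..L} (\<lambda>s. pd i f (x + s *\<^sub>R e)) = 0" for x
  proof -
    have "((\<lambda>s. pd i f (x + s *\<^sub>R e)) has_integral f (x + L *\<^sub>R e) - f (x + 0 *\<^sub>R e)) {0..L}"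
    proof (rule fundamental_theorem_of_calculus)
      fix s assume "s \<in> {0..L}"
      have "((\<lambda>s. f (x + s *\<^sub>R e)) has_derivative (\<lambda>v. frechet_derivative f (at (x + s *\<^sub>R e)) (v *\<^sub>R e))) (at s)"
        by (rule has_derivative_compose[where f = "\<lambda>s. x + s *\<^sub>R e" and f' = "\<lambda>v. v *\<^sub>R e", OF _ fd])
          (auto intro!: derivative_eq_intros)
      then have "((\<lambda>s. f (x + s *\<^sub>R e)) has_vector_derivative pd i f (x + s *\<^sub>R e)) (at s)"
        unfolding has_vector_derivative_def pd_def e_def[symmetric]
        using linear_scale[OF has_derivative_linear[OF fd]] by simp
      then show "((\<lambda>s. f (x + s *\<^sub>R e)) has_vector_derivative pd i f (x + s *\<^sub>R e)) (at s within {0..L})"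
        by (rule has_vector_derivative_at_within)
    qed (use L in simp)
    then show ?thesis using per by (simp add: integral_unique)
  qed
  have "integral (cbox 0 L) (\<lambda>s. integral (cbox a b) (\<lambda>x. pd i f (x + s *\<^sub>R e)))
      = integral (cbox a b) (\<lambda>x. integral (cbox 0 L) (\<lambda>s. pd i f (x + s *\<^sub>R e)))"
    by (rule integral_swap_continuous)
      (auto simp: case_prod_unfold intro!: continuous_intros continuous_on_compose2[OF gc])
  also have "\<dots> = 0" by (simp add: line)
  finally have "integral (cbox 0 L) (\<lambda>s. integral (cbox a b) (\<lambda>x. pd i f (x + s *\<^sub>R e))) = 0" .
  moreover have "integral (cbox 0 L) (\<lambda>s. integral (cbox a b) (\<lambda>x. pd i f (x + s *\<^sub>R e)))
      = integral (cbox 0 L) (\<lambda>s. integral (cbox a b) (pd i f))"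
    unfolding e_def using gper[unfolded e_def L_def]
    by (intro Henstock_Kurzweil_Integration.integral_cong integral_periodic_shift gc) (auto simp: L_def)
  ultimately show ?thesis using L by simp
qed

section \<open>The model\<close>

context stratonovich_calculus
begin

lemma A_integrable_cell:
  assumes "f \<in> A" "\<omega> \<in> space M" "t \<in> {0..T}"
  shows "(\<lambda>x. f x t \<omega>) integrable_on cbox a b"
  by (rule integrable_continuous[OF continuous_on_subset[OF A_continuous_space[OF assms]]]) simp

text \<open>
  The divergence of the noise field is the sum over \<open>n\<close> of the integrals of
  \<open>div \<phi>\<^sub>n \<circ> dB\<^sub>n\<close>: for each \<open>n\<close> the sums approximating the integrals of
  \<open>\<partial>\<^sub>i \<phi>\<^sub>n\<^sub>,\<^sub>i\<close> add up to 0.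
\<close>

lemma dv_noise_zero:
  fixes \<phi> :: "nat \<Rightarrow> ('d, 'w) vfield" and W :: "('d, 'w) vfield"
  assumes noise: "noise_field M T a b A N B \<phi> W"
    and div: "\<And>n x t \<omega>. n \<in> N \<Longrightarrow> t \<in> {0..T} \<Longrightarrow> \<omega> \<in> space M \<Longrightarrow> dv (\<phi> n) x t \<omega> = 0"
  shows "dv W \<doteq> (\<lambda>x t \<omega>. 0)"
proof (rule deqI)
  fix x
  have W: "cmp W i \<in> A" for i using noise by (simp add: noise_field_def)
  have "has_noise_integral M T N B (\<lambda>n. dx i (cmp (\<phi> n) i) x) (dx i (cmp W i) x)" for i
    using noise by (simp add: noise_field_def)
  then have "\<forall>i. \<exists>J. (\<forall>n\<in>N. has_strat_integral M T (dx i (cmp (\<phi> n) i) x) (B n) (J n)) \<and>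
      (\<forall>t\<in>{0..T}. tendsto_in_prob M (\<lambda>m \<omega>. \<Sum>n | n \<in> N \<and> n < m. J n t \<omega>) (dx i (cmp W i) x t))"
    unfolding has_noise_integral_def by simp
  from choice[OF this] obtain J
    where "\<forall>i. (\<forall>n\<in>N. has_strat_integral M T (dx i (cmp (\<phi> n) i) x) (B n) (J i n)) \<and>
      (\<forall>t\<in>{0..T}. tendsto_in_prob M (\<lambda>m \<omega>. \<Sum>n | n \<in> N \<and> n < m. J i n t \<omega>) (dx i (cmp W i) x t))"
    by (rule exE)
  then have J: "\<And>i n. n \<in> N \<Longrightarrow> has_strat_integral M T (dx i (cmp (\<phi> n) i) x) (B n) (J i n)"
    and lim: "\<And>i t. t \<in> {0..T} \<Longrightarrow>
      tendsto_in_prob M (\<lambda>m \<omega>. \<Sum>n | n \<in> N \<and> n < m. J i n t \<omega>) (dx i (cmp W i) x t)"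
    by simp_all
  have zero: "AE \<omega> in M. dv W x t \<omega> = 0" if t: "t \<in> {0..T}" for t
  proof -
    have J0: "AE \<omega> in M. (\<Sum>i\<in>UNIV. J i n t \<omega>) = 0" if n: "n \<in> N" for n
    proof -
      have 1: "tendsto_in_prob M (\<lambda>m \<omega>. \<Sum>i\<in>UNIV. ssum (dx i (cmp (\<phi> n) i) x) (B n) t m \<omega>)
          (\<lambda>\<omega>. \<Sum>i\<in>UNIV. J i n t \<omega>)"
        by (intro tendsto_in_prob_sum prob_space has_strat_integral_ssum[OF J] n t)
      have "(\<Sum>i\<in>UNIV. ssum (dx i (cmp (\<phi> n) i) x) (B n) t m \<omega>) = 0" if \<omega>: "\<omega> \<in> space M" for m \<omega>
      proof -
        have "(\<Sum>i\<in>UNIV. ssum (dx i (cmp (\<phi> n) i) x) (B n) t m \<omega>)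
            = ssum (\<lambda>s \<omega>. \<Sum>i\<in>UNIV. dx i (cmp (\<phi> n) i) x s \<omega>) (B n) t m \<omega>"
          by (rule ssum_sum_left[symmetric])
        also have "\<dots> = ssum (\<lambda>s \<omega>. 0) (B n) t m \<omega>"
          using div[OF n _ \<omega>, of _ x] by (intro ssum_cong[OF t]) (auto simp: dv_def)
        finally show ?thesis by (simp add: ssum_def strat_sum_def)
      qed
      then have "tendsto_in_prob M (\<lambda>m \<omega>. 0) (\<lambda>\<omega>. \<Sum>i\<in>UNIV. J i n t \<omega>)"
        by (intro tendsto_in_prob_cong[OF prob_space 1] AE_I2 tendsto_in_prob_measurable(2)[OF 1]) auto
      from tendsto_in_prob_unique[OF prob_space this tendsto_in_prob_const[OF prob_space]]
      show ?thesis by simp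
    qed
    have 2: "tendsto_in_prob M (\<lambda>m \<omega>. \<Sum>i\<in>UNIV. \<Sum>n | n \<in> N \<and> n < m. J i n t \<omega>) (dv W x t)"
      unfolding dv_def by (intro tendsto_in_prob_sum prob_space lim t)
    have "tendsto_in_prob M (\<lambda>m \<omega>. 0) (dv W x t)"
    proof (rule tendsto_in_prob_cong[OF prob_space 2])
      fix m
      have "AE \<omega> in M. \<forall>n\<in>{n. n \<in> N \<and> n < m}. (\<Sum>i\<in>UNIV. J i n t \<omega>) = 0"
        using J0 by (intro AE_ball_countable') auto
      then show "AE \<omega> in M. (\<Sum>i\<in>UNIV. \<Sum>n | n \<in> N \<and> n < m. J i n t \<omega>) = 0"
      proof eventually_elim
        case (elim \<omega>)
        have "(\<Sum>i\<in>UNIV. \<Sum>n | n \<in> N \<and> n < m. J i n t \<omega>) = (\<Sum>n | n \<in> N \<and> n < m. \<Sum>i\<in>UNIV. J i n t \<omega>)"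
          by (rule sum.swap)
        with elim show ?case by simp
      qed
    qed (use tendsto_in_prob_measurable(2)[OF 2] in auto)
    from tendsto_in_prob_unique[OF prob_space this tendsto_in_prob_const[OF prob_space]]
    show ?thesis by simp
  qed
  have "AE \<omega> in M. \<forall>t\<in>{0..T}. dv W x t \<omega> = 0"
    by (rule AE_all_if_continuous[OF zero]) (auto intro: A_continuous_time A_dv W)
  then show "AE \<omega> in M. \<forall>t\<in>{0..T}. dv W x t \<omega> - dv W x 0 \<omega> = 0 - 0"
    by (rule eventually_mono) (use T in simp)
qed

text \<open>
  The total displacement \<open>dV = \<epsilon> (u\<^sup>* dt + \<Upsilon>\<^bsup>1/2\<^esup> dW)\<close> of the model.
\<close>

definition displacement ::
    "real \<Rightarrow> real \<Rightarrow> ('d, 'w) vfield \<Rightarrow> ('d, 'w) vfield \<Rightarrow> ('d, 'w) vfield \<Rightarrow> 'd \<Rightarrow> ('d, 'w) field" where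
  "displacement \<epsilon> \<Upsilon> u us W i =
     (\<lambda>x t \<omega>. \<epsilon> * tint (cmp (ustar \<epsilon> \<Upsilon> u us) i) x t \<omega> + sqrt \<Upsilon> * \<epsilon> * cmp W i x t \<omega>)"

lemma cmp_ustar: "cmp (ustar \<epsilon> \<Upsilon> u us) i = (\<lambda>x t \<omega>. cmp u i x t \<omega> - 1 / 2 * \<Upsilon> * \<epsilon> * cmp us i x t \<omega>)"
  by (simp add: cmp_def ustar_def)

lemma D_ustar: "cmp u i \<in> A \<Longrightarrow> cmp us i \<in> D \<Longrightarrow> cmp (ustar \<epsilon> \<Upsilon> u us) i \<in> D"
  unfolding cmp_ustar by (rule D_diff[OF A_D D_cmult])

lemma A_displacement:
  "cmp u i \<in> A \<Longrightarrow> cmp us i \<in> D \<Longrightarrow> cmp W i \<in> A \<Longrightarrow> displacement \<epsilon> \<Upsilon> u us W i \<in> A"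
  unfolding displacement_def by (intro A_intros A_tint D_ustar)

lemma A_transport:
  assumes "\<And>i. cmp u i \<in> A" "\<And>i. cmp us i \<in> D" "\<And>i. cmp W i \<in> A" "f \<in> A"
  shows "transport M T A \<epsilon> \<Upsilon> u us W f \<in> A"
proof -
  have "(\<lambda>x t \<omega>. dx i f x t \<omega> * cmp (ustar \<epsilon> \<Upsilon> u us) i x t \<omega>) \<in> D" for i
    using assms by (intro D_mult D_ustar A_dx)
  then have "(\<lambda>x t \<omega>. \<Sum>i\<in>UNIV. ustar \<epsilon> \<Upsilon> u us x t \<omega> $ i * dx i f x t \<omega>) \<in> D"
    by (intro D_sum) (simp add: cmp_def mult.commute)
  then show ?thesis unfolding transport_def using assms by (intro A_intros A_tint)
qed

lemma transport_adv:
  assumes u: "\<And>i. cmp u i \<in> A" and us: "\<And>i. cmp us i \<in> D" and W: "\<And>i. cmp W i \<in> A" and f: "f \<in> A"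
  shows "transport M T A \<epsilon> \<Upsilon> u us W f \<doteq> adv (displacement \<epsilon> \<Upsilon> u us W) f"
proof -
  let ?v = "\<lambda>i. cmp (ustar \<epsilon> \<Upsilon> u us) i"
  have v: "?v i \<in> D" for i by (intro D_ustar u us)
  have S: "S (dx i f) (displacement \<epsilon> \<Upsilon> u us W i)
      \<doteq> (\<lambda>x t \<omega>. \<epsilon> * tint (dx i f \<odot> ?v i) x t \<omega> + sqrt \<Upsilon> * \<epsilon> * S (dx i f) (cmp W i) x t \<omega>)" for i
  proof -
    have "S (dx i f) (displacement \<epsilon> \<Upsilon> u us W i)
        \<doteq> (\<lambda>x t \<omega>. S (dx i f) (\<lambda>x t \<omega>. \<epsilon> * tint (?v i) x t \<omega>) x t \<omega>
          + S (dx i f) (\<lambda>x t \<omega>. sqrt \<Upsilon> * \<epsilon> * cmp W i x t \<omega>) x t \<omega>)"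
      unfolding displacement_def by (intro S_add_right A_intros A_tint v W f)
    also have "\<dots> \<doteq> (\<lambda>x t \<omega>. \<epsilon> * S (dx i f) (tint (?v i)) x t \<omega> + sqrt \<Upsilon> * \<epsilon> * S (dx i f) (cmp W i) x t \<omega>)"
      by (intro deq_add S_cmult_right A_intros A_tint v W f)
    also have "\<dots> \<doteq> (\<lambda>x t \<omega>. \<epsilon> * tint (dx i f \<odot> ?v i) x t \<omega> + sqrt \<Upsilon> * \<epsilon> * S (dx i f) (cmp W i) x t \<omega>)"
      by (intro deq_add deq_cmult deq_refl S_tint A_intros v f)
    finally show ?thesis .
  qed
  have "tint (\<lambda>x t \<omega>. \<Sum>i\<in>UNIV. ustar \<epsilon> \<Upsilon> u us x t \<omega> $ i * dx i f x t \<omega>)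
      = tint (\<lambda>x t \<omega>. \<Sum>i\<in>UNIV. dx i f x t \<omega> * ?v i x t \<omega>)"
    by (simp add: cmp_def mult.commute)
  also have "\<dots> \<doteq> (\<lambda>x t \<omega>. \<Sum>i\<in>UNIV. tint (dx i f \<odot> ?v i) x t \<omega>)"
    by (intro tint_sum D_mult A_dx f v) simp
  finally have "transport M T A \<epsilon> \<Upsilon> u us W f \<doteq> (\<lambda>x t \<omega>. f x t \<omega>
      + \<epsilon> * (\<Sum>i\<in>UNIV. tint (dx i f \<odot> ?v i) x t \<omega>)
      + sqrt \<Upsilon> * \<epsilon> * (\<Sum>i\<in>UNIV. S (dx i f) (cmp W i) x t \<omega>))"
    unfolding transport_def by (intro deq_add deq_cmult deq_refl)
  also have "\<dots> = (\<lambda>x t \<omega>. f x t \<omega>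
      + (\<Sum>i\<in>UNIV. \<epsilon> * tint (dx i f \<odot> ?v i) x t \<omega> + sqrt \<Upsilon> * \<epsilon> * S (dx i f) (cmp W i) x t \<omega>))"
    by (simp add: sum.distrib sum_distrib_left add.assoc)
  also have "\<dots> \<doteq> adv (displacement \<epsilon> \<Upsilon> u us W) f"
    unfolding adv_def by (intro deq_add deq_refl deq_sum deq_sym[OF S])
  finally show ?thesis .
qed

lemma dv_ustar:
  assumes u: "\<And>i. cmp u i \<in> A" and us: "\<And>i. cmp us i \<in> D"
    and div: "dv us x t \<omega> = 0" and t: "t \<in> {0..T}" and \<omega>: "\<omega> \<in> space M"
  shows "dv (ustar \<epsilon> \<Upsilon> u us) x t \<omega> = dv u x t \<omega>"
proof -
  have "dx i (cmp (ustar \<epsilon> \<Upsilon> u us) i) x t \<omega>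
      = dx i (cmp u i) x t \<omega> - 1 / 2 * \<Upsilon> * \<epsilon> * dx i (cmp us i) x t \<omega>" for i
    unfolding cmp_ustar dx_diff[OF A_D[OF u] D_cmult[OF us] \<omega> t] dx_cmult[OF us \<omega> t] ..
  then have "dv (ustar \<epsilon> \<Upsilon> u us) x t \<omega> = dv u x t \<omega> - 1 / 2 * \<Upsilon> * \<epsilon> * dv us x t \<omega>"
    unfolding dv_def by (simp only: sum_subtractf sum_distrib_left)
  then show ?thesis using div by simp
qed

lemma div_displacement:
  assumes u: "\<And>i. cmp u i \<in> A" and us: "\<And>i. cmp us i \<in> D" and W: "\<And>i. cmp W i \<in> A"
    and divW: "dv W \<doteq> (\<lambda>x t \<omega>. 0)"
    and divus: "\<And>x t \<omega>. t \<in> {0..T} \<Longrightarrow> \<omega> \<in> space M \<Longrightarrow> dv us x t \<omega> = 0"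
  shows "(\<lambda>x t \<omega>. \<Sum>i\<in>UNIV. dx i (displacement \<epsilon> \<Upsilon> u us W i) x t \<omega>) \<doteq> (\<lambda>x t \<omega>. \<epsilon> * tint (dv u) x t \<omega>)"
proof -
  let ?v = "\<lambda>i. cmp (ustar \<epsilon> \<Upsilon> u us) i"
  have v: "?v i \<in> D" for i by (intro D_ustar u us)
  have D: "(\<lambda>x t \<omega>. \<epsilon> * tint (?v i) x t \<omega>) \<in> D" "(\<lambda>x t \<omega>. sqrt \<Upsilon> * \<epsilon> * cmp W i x t \<omega>) \<in> D"
    "tint (?v i) \<in> D" "cmp W i \<in> D" for i
    by (intro D_cmult A_D A_tint v W)+
  have "(\<lambda>x t \<omega>. \<Sum>i\<in>UNIV. dx i (displacement \<epsilon> \<Upsilon> u us W i) x t \<omega>)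
      \<doteq> (\<lambda>x t \<omega>. \<Sum>i\<in>UNIV. \<epsilon> * dx i (tint (?v i)) x t \<omega> + sqrt \<Upsilon> * \<epsilon> * dx i (cmp W i) x t \<omega>)"
    unfolding displacement_def
    by (intro deq_eqI sum.cong refl) (simp only: dx_add[OF D(1,2)] dx_cmult[OF D(3)] dx_cmult[OF D(4)])
  also have "\<dots> = (\<lambda>x t \<omega>. \<epsilon> * (\<Sum>i\<in>UNIV. dx i (tint (?v i)) x t \<omega>) + sqrt \<Upsilon> * \<epsilon> * dv W x t \<omega>)"
    by (simp add: dv_def sum.distrib sum_distrib_left)
  also have "\<dots> \<doteq> (\<lambda>x t \<omega>. \<epsilon> * (\<Sum>i\<in>UNIV. tint (dx i (?v i)) x t \<omega>) + sqrt \<Upsilon> * \<epsilon> * 0)"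
    by (intro deq_add deq_cmult deq_sum divW dx_tint v)
  also have "\<dots> \<doteq> (\<lambda>x t \<omega>. \<epsilon> * tint (dv (ustar \<epsilon> \<Upsilon> u us)) x t \<omega> + sqrt \<Upsilon> * \<epsilon> * 0)"
    unfolding dv_def by (intro deq_add deq_cmult deq_refl deq_sym[OF tint_sum] D_dx v) simp
  also have "\<dots> \<doteq> (\<lambda>x t \<omega>. \<epsilon> * tint (dv u) x t \<omega> + sqrt \<Upsilon> * \<epsilon> * 0)"
    by (intro deq_add deq_cmult deq_refl tint_cong dv_ustar[OF u us] divus)
  finally show ?thesis by simp
qed

text \<open>
  Integration of a local conservation law over the cell; here the exceptional null set must not
  depend on the point.
\<close>

lemma integral_conserved:
  assumes cell: "\<And>i. a $ i < b $ i"
    and e: "e \<in> A" and \<Phi>: "\<And>j. \<Phi> j \<in> A" and law: "e \<doteq> (\<lambda>x t \<omega>. \<Sum>j\<in>UNIV. dx j (\<Phi> j) x t \<omega>)"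
  shows "AE \<omega> in M. \<forall>t\<in>{0..T}. integral (cbox a b) (\<lambda>x. e x t \<omega>) = integral (cbox a b) (\<lambda>x. e x 0 \<omega>)"
proof -
  let ?d = "\<lambda>x t \<omega>. \<Sum>j\<in>UNIV. dx j (\<Phi> j) x t \<omega>"
  have d: "?d \<in> A" by (intro A_intros \<Phi>)
  have 0: "0 \<in> {0..T}" using T by simp
  have flux: "integral (cbox a b) (\<lambda>x. ?d x t \<omega>) = 0" if t: "t \<in> {0..T}" and \<omega>: "\<omega> \<in> space M" for t \<omega>
  proof -
    have "integral (cbox a b) (\<lambda>x. dx j (\<Phi> j) x t \<omega>) = 0" for j
      unfolding dx_def by (rule integral_pd_periodic[OF D_smooth[OF A_D[OF \<Phi>] \<omega> t] cell])
    moreover have "integral (cbox a b) (\<lambda>x. ?d x t \<omega>) = (\<Sum>j\<in>UNIV. integral (cbox a b) (\<lambda>x. dx j (\<Phi> j) x t \<omega>))"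
      by (intro Henstock_Kurzweil_Integration.integral_sum A_integrable_cell[OF A_dx[OF \<Phi>] \<omega> t]) simp
    ultimately show ?thesis by simp
  qed
  show ?thesis
    using deq_all_points[OF e d law] AE_space
  proof eventually_elim
    case (elim \<omega>)
    show ?case
    proof
      fix t assume t: "t \<in> {0..T}"
      note int = A_integrable_cell[OF e elim(2)] A_integrable_cell[OF d elim(2)]
      have "integral (cbox a b) (\<lambda>x. e x t \<omega>) - integral (cbox a b) (\<lambda>x. e x 0 \<omega>)
          = integral (cbox a b) (\<lambda>x. e x t \<omega> - e x 0 \<omega>)"
        by (rule Henstock_Kurzweil_Integration.integral_diff[symmetric]) (intro int t 0)+
      also have "\<dots> = integral (cbox a b) (\<lambda>x. ?d x t \<omega> - ?d x 0 \<omega>)"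
        using elim(1) t by simp
      also have "\<dots> = integral (cbox a b) (\<lambda>x. ?d x t \<omega>) - integral (cbox a b) (\<lambda>x. ?d x 0 \<omega>)"
        by (rule Henstock_Kurzweil_Integration.integral_diff) (intro int t 0)+
      also have "\<dots> = 0" using flux[OF t elim(2)] flux[OF 0 elim(2)] by simp
      finally show "integral (cbox a b) (\<lambda>x. e x t \<omega>) = integral (cbox a b) (\<lambda>x. e x 0 \<omega>)" by simp
    qed
  qed
qed

end

theorem mainTheorem4:
  fixes M :: "'w measure" and F :: "real \<Rightarrow> 'w measure" and T :: real
    and a b :: "real^'d::finite"
    and \<epsilon> \<beta> \<Upsilon> :: real
    and N :: "nat set" and B :: "nat \<Rightarrow> 'w process"
    and A D :: "('d, 'w) field set"
    and \<eta> :: "('d, 'w) field" and u us W :: "('d, 'w) vfield"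
    and \<phi> :: "nat \<Rightarrow> ('d, 'w) vfield"
  assumes dim: "CARD('d) = 1 \<or> CARD('d) = 2"
    and cell: "\<And>i. a $ i < b $ i"
    and params: "0 < \<epsilon>" "0 < \<beta>" "0 < \<Upsilon>" "0 < T"
    and space: "filtered_prob_space M F"
    and BM: "independent_brownian_motions M F T N B"
    and calculus: "strat_calculus M F T a b A D"
    and noise: "noise_field M T a b A N B \<phi> W"
    and regular: "\<eta> \<in> A" "\<And>i. cmp u i \<in> A" "\<And>i. cmp us i \<in> D"
      "(\<lambda>x t \<omega>. 1 / depth \<epsilon> \<eta> x t \<omega>) \<in> A"
    and depth_pos: "\<And>x t \<omega>. t \<in> {0..T} \<Longrightarrow> \<omega> \<in> space M \<Longrightarrow> 0 < depth \<epsilon> \<eta> x t \<omega>"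
    and solution: "LU_SGN M T A \<epsilon> \<beta> \<Upsilon> \<eta> u us W"
    and noise_boundary: "\<And>n x t \<omega>. n \<in> N \<Longrightarrow> x \<in> frontier (cbox a b) \<Longrightarrow> t \<in> {0..T} \<Longrightarrow>
      \<omega> \<in> space M \<Longrightarrow> \<phi> n x t \<omega> = 0"
    and noise_div_free: "\<And>n x t \<omega>. n \<in> N \<Longrightarrow> t \<in> {0..T} \<Longrightarrow> \<omega> \<in> space M \<Longrightarrow> dv (\<phi> n) x t \<omega> = 0"
    and drift_div_free: "\<And>x t \<omega>. t \<in> {0..T} \<Longrightarrow> \<omega> \<in> space M \<Longrightarrow> dv us x t \<omega> = 0"
  shows "AE \<omega> in M. \<forall>t\<in>{0..T}. SGN_energy a b \<epsilon> \<beta> \<eta> u t \<omega> = SGN_energy a b \<epsilon> \<beta> \<eta> u 0 \<omega>"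
proof -
  interpret stratonovich_calculus M F T a b A D
    using space params(4) calculus by unfold_locales
  define h where "h = depth \<epsilon> \<eta>"
  define w where "w = dv u"
  define V where "V = displacement \<epsilon> \<Upsilon> u us W"
  define G where "G = LU_G M T A \<epsilon> \<Upsilon> u us W"
  define K where "K = S (\<lambda>x t \<omega>. h x t \<omega> ^ 3 / 3) G"
  note \<eta> = regular(1) and u = regular(2) and us = regular(3)
  have W: "cmp W i \<in> A" for i using noise by (simp add: noise_field_def)
  have h: "h \<in> A" unfolding h_def depth_def by (intro A_intros \<eta>)
  have w: "w \<in> A" unfolding w_def by (intro A_intros u)
  have V: "V i \<in> A" for i unfolding V_def by (intro A_displacement u us W)
  have divW: "dv W \<doteq> (\<lambda>x t \<omega>. 0)" by (rule dv_noise_zero[OF noise noise_div_free])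
  have dvW: "dv W \<in> A" by (intro A_intros W)
  have S_dvW: "S f (dv W) \<doteq> (\<lambda>x t \<omega>. 0)" if "f \<in> A" for f
  proof -
    have "S f (dv W) \<doteq> S f (\<lambda>x t \<omega>. 0)" by (intro S_cong_right divW dvW A_const that)
    also have "\<dots> \<doteq> (\<lambda>x t \<omega>. 0)" by (rule S_const_right[OF that])
    finally show ?thesis .
  qed
  have dv': "dv (ustar \<epsilon> \<Upsilon> u us) x t \<omega> = w x t \<omega>" if "t \<in> {0..T}" "\<omega> \<in> space M" for x t \<omega>
    unfolding w_def using that by (intro dv_ustar u us drift_div_free)

  \<comment> \<open>the three equations of the model in terms of the displacement\<close>
  have mass: "adv V h \<doteq> (\<lambda>x t \<omega>. - \<epsilon> * tint (h \<odot> w) x t \<omega>)"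
  proof -
    have "adv V h \<doteq> (\<lambda>x t \<omega>. adv V (\<lambda>x t \<omega>. 1) x t \<omega> + adv V (\<lambda>x t \<omega>. \<epsilon> * \<eta> x t \<omega>) x t \<omega>)"
      unfolding h_def depth_def by (intro adv_add A_intros V \<eta>)
    also have "\<dots> \<doteq> (\<lambda>x t \<omega>. 0 + \<epsilon> * adv V \<eta> x t \<omega>)"
      by (intro deq_add adv_const adv_cmult V \<eta>)
    also have "\<dots> \<doteq> (\<lambda>x t \<omega>. 0 + \<epsilon> * transport M T A \<epsilon> \<Upsilon> u us W \<eta> x t \<omega>)"
      unfolding V_def by (intro deq_add deq_cmult deq_refl deq_sym[OF transport_adv] u us W \<eta>)
    also have "\<dots> \<doteq> (\<lambda>x t \<omega>. 0 + \<epsilon> * - (tint (\<lambda>x t \<omega>. h x t \<omega> * dv (ustar \<epsilon> \<Upsilon> u us) x t \<omega>) x t \<omega>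
        + sqrt \<Upsilon> * S h (dv W) x t \<omega>))"
      using solution unfolding LU_SGN_def Let_def h_def by (intro deq_add deq_cmult deq_refl) blast
    also have "\<dots> = (\<lambda>x t \<omega>. - \<epsilon> * (tint (\<lambda>x t \<omega>. h x t \<omega> * dv (ustar \<epsilon> \<Upsilon> u us) x t \<omega>) x t \<omega>
        + sqrt \<Upsilon> * S h (dv W) x t \<omega>))" by (simp add: algebra_simps)
    also have "\<dots> \<doteq> (\<lambda>x t \<omega>. - \<epsilon> * (tint (h \<odot> w) x t \<omega> + sqrt \<Upsilon> * 0))"
      by (intro deq_cmult deq_add tint_cong S_dvW h) (simp only: dv')
    finally show ?thesis by simp
  qed
  have GA: "G \<in> A"
  proof -
    have "(\<lambda>x t \<omega>. w x t \<omega> * dv (ustar \<epsilon> \<Upsilon> u us) x t \<omega>) \<in> D"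
      by (intro D_mult w D_dv D_ustar u us)
    then have "tint (\<lambda>x t \<omega>. dv (ustar \<epsilon> \<Upsilon> u us) x t \<omega> * dv u x t \<omega>) \<in> A"
      unfolding w_def by (intro A_tint) (simp add: mult.commute)
    then show ?thesis
      unfolding G_def LU_G_def by (intro A_intros A_transport u us W)
  qed
  have GD: "G \<doteq> (\<lambda>x t \<omega>. adv V w x t \<omega> - \<epsilon> * tint (w \<odot> w) x t \<omega>)"
  proof -
    have "G \<doteq> (\<lambda>x t \<omega>. adv V w x t \<omega> - \<epsilon> * (tint (w \<odot> w) x t \<omega> + sqrt \<Upsilon> * 0))"
      unfolding G_def LU_G_def V_def w_def[symmetric]
      by (intro deq_diff deq_cmult deq_add transport_adv tint_cong S_dvW u us W w) (simp only: dv')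
    then show ?thesis by simp
  qed
  have momentum: "(\<lambda>x t \<omega>. adv V (cmp u j) x t \<omega> + tint (dx j \<eta>) x t \<omega>
      - (\<epsilon> * \<beta>\<^sup>2) * S (\<lambda>x t \<omega>. 1 / h x t \<omega>) (dx j K) x t \<omega>) \<doteq> (\<lambda>x t \<omega>. 0)" for j
  proof -
    have "(\<lambda>x t \<omega>. adv V (cmp u j) x t \<omega> + tint (dx j \<eta>) x t \<omega>
        - (\<epsilon> * \<beta>\<^sup>2) * S (\<lambda>x t \<omega>. 1 / h x t \<omega>) (dx j K) x t \<omega>)
      \<doteq> (\<lambda>x t \<omega>. transport M T A \<epsilon> \<Upsilon> u us W (cmp u j) x t \<omega> + tint (dx j \<eta>) x t \<omega>
        - (\<epsilon> * \<beta>\<^sup>2) * S (\<lambda>x t \<omega>. 1 / h x t \<omega>) (dx j K) x t \<omega>)"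
      unfolding V_def by (intro deq_diff deq_add deq_refl deq_sym[OF transport_adv] u us W)
    also have "\<dots> \<doteq> (\<lambda>x t \<omega>. 0)"
      using solution unfolding LU_SGN_def Let_def h_def K_def G_def by blast
    finally show ?thesis .
  qed
  have dh: "dx j h x t \<omega> = \<epsilon> * dx j \<eta> x t \<omega>" if "t \<in> {0..T}" "\<omega> \<in> space M" for j x t \<omega>
    unfolding h_def depth_def
    using dx_add[OF A_D[OF A_const] D_cmult[OF A_D[OF \<eta>]] that(2,1), of j 1 \<epsilon> x]
      dx_cmult[OF A_D[OF \<eta>] that(2,1), of j \<epsilon> x] by (simp add: dx_const)
  have hr: "h x t \<omega> * (1 / h x t \<omega>) = 1" if "t \<in> {0..T}" "\<omega> \<in> space M" for x t \<omega>
    using depth_pos[OF that, of x] by (simp add: h_def)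
  have divV: "(\<lambda>x t \<omega>. \<Sum>i\<in>UNIV. dx i (V i) x t \<omega>) \<doteq> (\<lambda>x t \<omega>. \<epsilon> * tint w x t \<omega>)"
    unfolding V_def w_def by (intro div_displacement u us W divW drift_div_free)

  define e where "e = (\<lambda>x t \<omega>. h x t \<omega> * (\<epsilon>\<^sup>2 / 2 * (\<Sum>j\<in>UNIV. cmp u j x t \<omega> * cmp u j x t \<omega>)
      + 1 / 2 * h x t \<omega> + \<epsilon>\<^sup>2 * (\<epsilon> * \<beta>\<^sup>2) / 6 * ((h x t \<omega> * w x t \<omega>) * (h x t \<omega> * w x t \<omega>))))"
  have e: "e \<in> A" unfolding e_def by (intro A_intros h u w)
  have w_eq: "w = (\<lambda>x t \<omega>. \<Sum>i\<in>UNIV. dx i (cmp u i) x t \<omega>)" unfolding w_def dv_def ..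
  have r: "(\<lambda>x t \<omega>. 1 / h x t \<omega>) \<in> A" unfolding h_def by (rule regular(4))
  have "\<exists>\<Phi>. (\<forall>j. \<Phi> j \<in> A) \<and> e \<doteq> (\<lambda>x t \<omega>. \<Sum>j\<in>UNIV. dx j (\<Phi> j) x t \<omega>)"
    by (rule local_energy_law[OF w_eq K_def e_def V h \<eta> r GA u hr dh divV mass GD momentum])
  then obtain \<Phi> where "\<And>j. \<Phi> j \<in> A" "e \<doteq> (\<lambda>x t \<omega>. \<Sum>j\<in>UNIV. dx j (\<Phi> j) x t \<omega>)" by blast
  from integral_conserved[OF cell e this]
  have conserved: "AE \<omega> in M. \<forall>t\<in>{0..T}.
      integral (cbox a b) (\<lambda>x. e x t \<omega>) = integral (cbox a b) (\<lambda>x. e x 0 \<omega>)" .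
  have energy: "SGN_energy a b \<epsilon> \<beta> \<eta> u t \<omega> = integral (cbox a b) (\<lambda>x. e x t \<omega>)"
    if t: "t \<in> {0..T}" and \<omega>: "\<omega> \<in> space M" for t \<omega>
  proof -
    let ?k = "\<lambda>x t \<omega>. h x t \<omega> * (\<Sum>j\<in>UNIV. cmp u j x t \<omega> * cmp u j x t \<omega>)"
    let ?p = "\<lambda>x t \<omega>. (h x t \<omega>)\<^sup>2"
    let ?d = "\<lambda>x t \<omega>. h x t \<omega> ^ 3 * (w x t \<omega>)\<^sup>2"
    have "?k \<in> A" "?p \<in> A" "?d \<in> A" by (intro A_intros h u w)+
    note int = this[THEN A_integrable_cell[OF _ \<omega> t]]
    have norm: "(norm (u x t \<omega>))\<^sup>2 = (\<Sum>j\<in>UNIV. cmp u j x t \<omega> * cmp u j x t \<omega>)" for x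
      by (simp add: power2_norm_eq_inner inner_vec_def cmp_def)
    have expand: "y * (\<epsilon>\<^sup>2 / 2 * s + 1 / 2 * y + \<epsilon>\<^sup>2 * (\<epsilon> * \<beta>\<^sup>2) / 6 * ((y * z) * (y * z)))
        = \<epsilon>\<^sup>2 / 2 * (y * s) + 1 / 2 * y\<^sup>2 + \<epsilon> ^ 3 * \<beta>\<^sup>2 / 6 * (y ^ 3 * z\<^sup>2)" for y z s :: real
      by (simp add: algebra_simps power2_eq_square power3_eq_cube)
    have "e x t \<omega> = \<epsilon>\<^sup>2 / 2 * ?k x t \<omega> + 1 / 2 * ?p x t \<omega> + \<epsilon> ^ 3 * \<beta>\<^sup>2 / 6 * ?d x t \<omega>" for x
      unfolding e_def by (rule expand)
    then have "integral (cbox a b) (\<lambda>x. e x t \<omega>)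
        = integral (cbox a b) (\<lambda>x. \<epsilon>\<^sup>2 / 2 * ?k x t \<omega> + 1 / 2 * ?p x t \<omega> + \<epsilon> ^ 3 * \<beta>\<^sup>2 / 6 * ?d x t \<omega>)"
      by simp
    also have "\<dots> = integral (cbox a b) (\<lambda>x. \<epsilon>\<^sup>2 / 2 * ?k x t \<omega>) + integral (cbox a b) (\<lambda>x. 1 / 2 * ?p x t \<omega>)
        + integral (cbox a b) (\<lambda>x. \<epsilon> ^ 3 * \<beta>\<^sup>2 / 6 * ?d x t \<omega>)"
    proof -
      note scaled = int[THEN integrable_on_mult_right]
      show ?thesis
        unfolding Henstock_Kurzweil_Integration.integral_add[OF integrable_add[OF scaled(1,2)] scaled(3)]
          Henstock_Kurzweil_Integration.integral_add[OF scaled(1,2)] ..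
    qed
    also have "\<dots> = SGN_energy a b \<epsilon> \<beta> \<eta> u t \<omega>"
      unfolding SGN_energy_def norm h_def[symmetric] w_def[symmetric] integral_mult_right ..
    finally show ?thesis ..
  qed
  show ?thesis
    using conserved AE_space
  proof eventually_elim
    case (elim \<omega>)
    show ?case
    proof
      fix t assume t: "t \<in> {0..T}"
      have 0: "0 \<in> {0..T}" using T by simp
      show "SGN_energy a b \<epsilon> \<beta> \<eta> u t \<omega> = SGN_energy a b \<epsilon> \<beta> \<eta> u 0 \<omega>"
        unfolding energy[OF t elim(2)] energy[OF 0 elim(2)] using elim(1) t by (rule bspec)
    qed
  qed
qed

end
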